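(* Let $\lambda\in\mathbb{C}\setminus\{0\}$. Then the equation $-(\Psi w u')'=\lambda w u$ on $(0,\infty)$ has two linearly independent solutions $u_+$ and $u_-$ of the form $$u_\pm(x)=x^{-1/4}e^{x^2/2}P_0(x)\exp\left\{\pm i\sqrt{\frac{8\lambda}{25}}\,P_1(x)\,x^{5/2}\right\}\left[1+O\left(x^{-7/2}\right)\right]\qquad(x\to\infty),$$ where $$P_0(x)=1+\frac{1}{8x\lambda}+\frac{5}{128x^2\lambda^2}+\frac{15}{1024x^3\lambda^3},$$ $$P_1(x)=1-\frac{5}{12x\lambda}-\frac{5}{32x^2\lambda^2}+\frac{5}{128x^3\lambda^3}+\frac{25}{6144x^4\lambda^4}+\frac{7-1152\lambda^4}{8192x^5\lambda^5}.$$
   Context: Here $\Psi(x)=\frac{1}{2x^3}\left[\operatorname{erf}(x)-\frac{2}{\sqrt\pi}xe^{-x^2}\right]$ with $\operatorname{erf}(x)=\frac{2}{\sqrt\pi}\int_0^xe^{-s^2}ds$, and $w(x)=x^2e^{-x^2}$. The square root is the principal branch, with $\sqrt{\lambda}=i\sqrt{|\lambda|}$ when $\lambda<0$. *)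

theory Defs
  imports "HOL-Analysis.Analysis" "HOL-Library.Landau_Symbols"
begin

definition erf :: "real \<Rightarrow> real" where
  "erf x = 2 / sqrt pi * (LBINT s=0..x. exp (- (s\<^sup>2)))"

definition Psi :: "real \<Rightarrow> real" where
  "Psi x = 1 / (2 * x ^ 3) * (erf x - 2 / sqrt pi * x * exp (- (x\<^sup>2)))"

definition weight :: "real \<Rightarrow> real" where
  "weight x = x\<^sup>2 * exp (- (x\<^sup>2))"

text \<open>A classical solution of \<open>-(\<Psi> w u')' = \<lambda> w u\<close> on \<open>(0,\<infinity>)\<close>, complex-valued since
  \<open>\<lambda>\<close> is complex: both \<open>u\<close> and \<open>\<Psi> w u'\<close> are differentiable.\<close>

definition solves :: "complex \<Rightarrow> (real \<Rightarrow> complex) \<Rightarrow> bool" where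
  "solves lam u \<longleftrightarrow>
     (\<exists>u' v' :: real \<Rightarrow> complex. \<forall>x>0.
        (u has_vector_derivative u' x) (at x) \<and>
        ((\<lambda>t. of_real (Psi t * weight t) * u' t) has_vector_derivative v' x) (at x) \<and>
        - v' x = lam * of_real (weight x) * u x)"

definition lin_indep_on_pos :: "(real \<Rightarrow> complex) \<Rightarrow> (real \<Rightarrow> complex) \<Rightarrow> bool" where
  "lin_indep_on_pos u v \<longleftrightarrow>
     (\<forall>a b :: complex. (\<forall>x>0. a * u x + b * v x = 0) \<longrightarrow> a = 0 \<and> b = 0)"

definition P0 :: "complex \<Rightarrow> real \<Rightarrow> complex" where
  "P0 lam x = 1 + 1 / (8 * of_real x * lam) + 5 / (128 * of_real x ^ 2 * lam ^ 2)
     + 15 / (1024 * of_real x ^ 3 * lam ^ 3)"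

definition P1 :: "complex \<Rightarrow> real \<Rightarrow> complex" where
  "P1 lam x = 1 - 5 / (12 * of_real x * lam) - 5 / (32 * of_real x ^ 2 * lam ^ 2)
     + 5 / (128 * of_real x ^ 3 * lam ^ 3) + 25 / (6144 * of_real x ^ 4 * lam ^ 4)
     + (7 - 1152 * lam ^ 4) / (8192 * of_real x ^ 5 * lam ^ 5)"

text \<open>\<open>csqrt\<close> is the principal branch with \<open>csqrt \<lambda> = \<i> * sqrt \<bar>\<lambda>\<bar>\<close> for \<open>\<lambda> < 0\<close>.
  The parameter \<open>s\<close> is the sign \<open>\<plusminus>1\<close>.\<close>

definition leading_form :: "complex \<Rightarrow> complex \<Rightarrow> real \<Rightarrow> complex" where
  "leading_form lam s x =
     of_real (x powr (-1/4)) * of_real (exp (x\<^sup>2 / 2)) * P0 lam x *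
     exp (s * \<i> * csqrt (8 * lam / 25) * P1 lam x * of_real (x powr (5/2)))"

text \<open>The identity is only required near infinity, since \<open>P0\<close> may vanish at some \<open>x > 0\<close>.\<close>

definition has_asymptotic_form :: "complex \<Rightarrow> complex \<Rightarrow> (real \<Rightarrow> complex) \<Rightarrow> bool" where
  "has_asymptotic_form lam s u \<longleftrightarrow>
     (\<exists>r :: real \<Rightarrow> complex.
        r \<in> O[at_top](\<lambda>x. of_real (x powr (-7/2))) \<and>
        (\<forall>\<^sub>F x in at_top. u x = leading_form lam s x * (1 + r x)))"

end

theory Submission
  imports Defs "HOL-Probability.Probability" "HOL-Real_Asymp.Real_Asymp"
begin

text \<open>
  Putting \<open>u = x\<^sup>1\<^sup>/\<^sup>2 exp (x\<^sup>2 / 2) y\<close> in \<open>-(\<Psi> w u')' = \<lambda> w u\<close> gives, up to exponentially small terms,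
  \<open>y'' + (2 \<lambda> x\<^sup>3 - x\<^sup>2 - 3 / (4 x\<^sup>2)) y = 0\<close>. With the explicit phase \<open>\<theta> = sqrt (8 \<lambda> / 25) P1 x\<^sup>5\<^sup>/\<^sup>2\<close> and
  an amplitude \<open>A\<close> normalised so that \<open>\<Psi> w A\<^sup>2 \<theta>'\<close> is constant, the functions
  \<open>A exp (\<plusminus>\<i> \<theta>)\<close> both solve the equation up to the same residual, whose quotient by \<open>\<theta>'\<close> is
  \<open>O(x\<^sup>-\<^sup>9\<^sup>/\<^sup>2)\<close>; the coefficients of \<open>P1\<close> are exactly those that achieve this. Writing a solution
  as \<open>A exp (\<plusminus>\<i> \<theta>) h\<close> turns the equation into a Volterra-type equation for \<open>h\<close>, which is
  solved by contraction near infinity and gives \<open>h = 1 + O(x\<^sup>-\<^sup>7\<^sup>/\<^sup>2)\<close>, the integral of the residual.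
  Finally \<open>A\<close> agrees with \<open>x\<^sup>-\<^sup>1\<^sup>/\<^sup>4 exp (x\<^sup>2 / 2) P0\<close> up to a factor \<open>1 + O(x\<^sup>-\<^sup>4)\<close>, and local solutions
  extend to \<open>(0,\<infinity>)\<close> because the equation is linear.
\<close>

section \<open>Antiderivatives, contractions and linear equations on the half-line\<close>

text \<open>Where the coefficients come from: with \<open>\<theta>' ~ x^(3/2)\<close>, the amplitude
  of \<open>y\<close> is about \<open>x^(-3/4)\<close>, whose second derivative adds
  \<open>21/16 x^-2\<close> to the \<open>-3/4 x^-2\<close> of the equation. The phase should
  therefore satisfy \<open>\<theta>'^2 = 2 lam x^3 - x^2 + 9/(16 x^2)\<close>, that is,
  \<open>\<theta>' = a x^(3/2) q\<close> with \<open>q\<close> the square root of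
  \<open>1 - 1/(2 lam x) + 9/(32 lam x^5)\<close> truncated after \<open>x^-5\<close>. The
  \<open>9/32\<close> is the source of the \<open>1152 lam^4\<close> in \<open>P1\<close>.
  Integrating \<open>a x^(3/2) q\<close> term by term gives \<open>P1\<close>, and \<open>P0\<close>
  is \<open>q^(-1/2)\<close> truncated after \<open>x^-3\<close>. The obstacle is that
  \<open>lam\<close> may be complex: one of the two exponentials can grow while the other decays, so
  the end at which the Volterra integral is based must depend on the sign of the exponent. Linear
  independence is read off a Wronskian. For this the flux \<open>v = \<Psi> w u'\<close> is
  constructed together with \<open>u\<close> and has its own explicit formula, so that no
  \<open>O\<close>-term is ever differentiated.\<close>

lemma continuous_antiderivative_real:
  fixes f :: "real \<Rightarrow> 'a::euclidean_space"
  assumes "continuous_on UNIV f"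
  shows "\<exists>F. \<forall>t. (F has_vector_derivative f t) (at t)"
  using einterval_antiderivative[of "-\<infinity>" "\<infinity>" f] assms
  by (auto simp: continuous_on_eq_continuous_at)

lemma continuous_antiderivative_pos:
  fixes f :: "real \<Rightarrow> 'a::euclidean_space"
  assumes "continuous_on {0<..} f"
  shows "\<exists>F. \<forall>t>0. (F has_vector_derivative f t) (at t)"
  using einterval_antiderivative[of 0 "\<infinity>" f] assms
  by (auto simp: continuous_on_eq_continuous_at zero_ereal_def)

lemma has_vector_derivative_quotient:
  fixes f g :: "real \<Rightarrow> complex"
  assumes "(f has_vector_derivative f') (at x)" "(g has_vector_derivative g') (at x)" "g x \<noteq> 0"
  shows "((\<lambda>x. f x / g x) has_vector_derivative (f' * g x - f x * g') / (g x)\<^sup>2) (at x)"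
proof -
  have "((\<lambda>x. inverse (g x)) has_vector_derivative g' * - (inverse (g x) ^ Suc (Suc 0))) (at x)"
    using field_vector_diff_chain_at[OF assms(2) DERIV_inverse[OF assms(3)]] by (simp add: o_def)
  from has_vector_derivative_mult[OF assms(1) this] show ?thesis
    using assms(3) by (simp add: divide_inverse power2_eq_square algebra_simps)
qed

text \<open>Takes the place of an integral estimate: the integral of the bound appears as the
  increment of an explicit real antiderivative \<open>\<phi>\<close>.\<close>

lemma norm_increment_le:
  fixes f :: "real \<Rightarrow> 'a::real_normed_vector"
  assumes "a \<le> b"
    and "\<And>x. a \<le> x \<Longrightarrow> x \<le> b \<Longrightarrow> (f has_vector_derivative f' x) (at x)"
    and "\<And>x. a \<le> x \<Longrightarrow> x \<le> b \<Longrightarrow> (\<phi> has_real_derivative \<phi>' x) (at x)"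
    and "\<And>x. a \<le> x \<Longrightarrow> x \<le> b \<Longrightarrow> norm (f' x) \<le> \<phi>' x"
  shows "norm (f b - f a) \<le> \<phi> b - \<phi> a"
proof (cases "a = b")
  case False
  with assms(1) have "a < b" by simp
  then show ?thesis
  proof (rule differentiable_bound_general[where f' = f' and \<phi>' = \<phi>'])
    show "continuous_on {a..b} f"
      using assms(2) by (meson atLeastAtMost_iff continuous_at_imp_continuous_on
          has_vector_derivative_continuous)
    show "continuous_on {a..b} \<phi>"
      using assms(3) by (meson DERIV_isCont atLeastAtMost_iff continuous_at_imp_continuous_on)
  qed (use assms in \<open>auto simp: has_real_derivative_iff_has_vector_derivative\<close>)
qed auto

text \<open>The maps \<open>i\<close> and \<open>j\<close> transport functions on \<open>S\<close> to bounded continuous functions on all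
  of \<open>\<real>\<close>, where completeness is available.\<close>

lemma weighted_contraction_fixpoint:
  fixes T :: "(real \<Rightarrow> 'b::banach) \<Rightarrow> real \<Rightarrow> 'b" and W :: "real \<Rightarrow> real"
    and i j :: "real \<Rightarrow> real" and S :: "real set"
  defines "C \<equiv> {h. continuous_on S h \<and> (\<exists>B. \<forall>t\<in>S. norm (h t) \<le> B * W t)}"
  assumes i: "continuous_on UNIV i" "range i \<subseteq> S"
    and j: "continuous_on S j" "\<And>t. t \<in> S \<Longrightarrow> i (j t) = t"
    and W: "continuous_on S W" "\<And>t. t \<in> S \<Longrightarrow> W t > 0"
    and T: "\<And>h. h \<in> C \<Longrightarrow> T h \<in> C"
    and contr: "\<And>g h D. g \<in> C \<Longrightarrow> h \<in> C \<Longrightarrow> D \<ge> 0 \<Longrightarrow> (\<And>t. t \<in> S \<Longrightarrow> norm (g t - h t) \<le> D * W t)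
                  \<Longrightarrow> (\<And>t. t \<in> S \<Longrightarrow> norm (T g t - T h t) \<le> D / 2 * W t)"
  shows "\<exists>h\<in>C. \<forall>t\<in>S. T h t = h t"
proof -
  \<comment> \<open>\<open>dn\<close> divides by the weight and \<open>up\<close> multiplies by it,
    so the sup norm of \<open>dn h\<close> is the \<open>W\<close>-weighted norm of
    \<open>h\<close>, in which \<open>T\<close> is assumed to contract by 1/2.\<close>
  define up :: "(real \<Rightarrow>\<^sub>C 'b) \<Rightarrow> real \<Rightarrow> 'b" where "up f t = W t *\<^sub>R f (j t)" for f t
  define dn where "dn h \<tau> = h (i \<tau>) /\<^sub>R W (i \<tau>)" for h :: "real \<Rightarrow> 'b" and \<tau>
  define \<Phi> where "\<Phi> f = Bcontfun (dn (T (up f)))" for f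
  have iS: "i \<tau> \<in> S" for \<tau> using i(2) by auto
  have up_C: "up f \<in> C" for f
  proof -
    have "continuous_on S (\<lambda>t. W t *\<^sub>R f (j t))"
      by (intro continuous_intros W continuous_on_compose2[OF continuous_on_apply_bcontfun j(1)]) auto
    moreover have "norm (up f t) \<le> norm f * W t" if "t \<in> S" for t
      using W(2)[OF that] norm_bounded[of f "j t"] by (simp add: up_def mult.commute)
    ultimately show ?thesis unfolding C_def up_def by blast
  qed
  have dn_b: "dn h \<in> bcontfun" if h: "h \<in> C" for h
  proof -
    obtain B where B: "\<And>t. t \<in> S \<Longrightarrow> norm (h t) \<le> B * W t" and ch: "continuous_on S h"
      using h unfolding C_def by auto
    have "continuous_on UNIV (\<lambda>\<tau>. h (i \<tau>))" "continuous_on UNIV (\<lambda>\<tau>. W (i \<tau>))"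
      by (auto intro!: continuous_on_compose2[OF ch i(1)] continuous_on_compose2[OF W(1) i(1)] iS)
    moreover have "W (i \<tau>) \<noteq> 0" for \<tau> using W(2)[OF iS, of \<tau>] by simp
    ultimately have "continuous_on UNIV (dn h)"
      unfolding dn_def by (intro continuous_intros) auto
    moreover have "norm (dn h \<tau>) \<le> B" for \<tau>
      using B[OF iS, of \<tau>] W(2)[OF iS, of \<tau>] by (simp add: dn_def field_simps)
    ultimately show ?thesis by (rule bcontfun_normI)
  qed
  have \<Phi>: "apply_bcontfun (\<Phi> f) = dn (T (up f))" for f
    unfolding \<Phi>_def by (rule Bcontfun_inverse) (intro dn_b T up_C)
  have "dist (\<Phi> f) (\<Phi> g) \<le> (1/2) * dist f g" for f g
  proof (rule dist_bound)
    fix \<tau>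
    have "norm (up f t - up g t) \<le> dist f g * W t" if "t \<in> S" for t
    proof -
      have "norm (up f t - up g t) = W t * dist (f (j t)) (g (j t))"
        using W(2)[OF that] unfolding up_def dist_norm scaleR_diff_right[symmetric] norm_scaleR
        by simp
      then show ?thesis using dist_bounded[of f "j t" g] W(2)[OF that] by (simp add: mult.commute)
    qed
    from contr[OF up_C up_C zero_le_dist this iS, of \<tau>]
    have "norm (T (up f) (i \<tau>) - T (up g) (i \<tau>)) \<le> dist f g / 2 * W (i \<tau>)" by simp
    then show "dist (\<Phi> f \<tau>) (\<Phi> g \<tau>) \<le> (1/2) * dist f g"
      using W(2)[OF iS, of \<tau>]
      unfolding \<Phi> dn_def dist_norm scaleR_diff_right[symmetric] norm_scaleR
      by (simp add: field_simps)
  qed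
  then obtain f where f: "\<Phi> f = f"
    using banach_fix_type[of "1/2" \<Phi>] by auto
  have "T (up f) t = up f t" if "t \<in> S" for t
  proof -
    have "f (j t) = dn (T (up f)) (j t)" using \<Phi>[of f] f by simp
    then have "f (j t) = T (up f) t /\<^sub>R W t"
      using j(2)[OF that] by (simp add: dn_def)
    then show ?thesis using W(2)[OF that] by (simp add: up_def)
  qed
  then show ?thesis using up_C by blast
qed

text \<open>Picard iteration in a Bielecki norm: the weight grows so fast, in terms of the integral
  of \<open>L\<close>, that the integral operator contracts on all of \<open>(0,\<infinity>)\<close>
  at once, and no local solutions have to be glued.\<close>

proposition linear_ode_solution_pos:
  fixes f :: "real \<Rightarrow> 'b::euclidean_space \<Rightarrow> 'b" and L :: "real \<Rightarrow> real"
  assumes f0: "\<And>t. f t 0 = 0"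
    and lip: "\<And>t x y. t > 0 \<Longrightarrow> norm (f t x - f t y) \<le> L t * norm (x - y)"
    and cf: "\<And>h. continuous_on {0<..} h \<Longrightarrow> continuous_on {0<..} (\<lambda>t. f t (h t))"
    and L: "continuous_on {0<..} L" "\<And>t. t > 0 \<Longrightarrow> L t \<ge> 0"
  shows "\<exists>y. y 1 = y0 \<and> (\<forall>t>0. (y has_vector_derivative f t (y t)) (at t))"
proof -
  obtain \<Lambda>0 where \<Lambda>0: "\<And>t. t > 0 \<Longrightarrow> (\<Lambda>0 has_vector_derivative L t) (at t)"
    using continuous_antiderivative_pos[OF L(1)] by blast
  define \<Lambda> where "\<Lambda> t = \<Lambda>0 t - \<Lambda>0 1" for t
  have \<Lambda>: "(\<Lambda> has_real_derivative L t) (at t)" if "t > 0" for t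
    unfolding \<Lambda>_def has_real_derivative_iff_has_vector_derivative
    using has_vector_derivative_diff[OF \<Lambda>0[OF that] has_vector_derivative_const] by simp
  have \<Lambda>_mono: "\<Lambda> s \<le> \<Lambda> t" if "0 < s" "s \<le> t" for s t
    by (rule DERIV_nonneg_imp_nondecreasing) (use \<Lambda> L(2) that in \<open>meson less_le_trans\<close>)+
  have \<Lambda>1: "\<Lambda> 1 = 0" by (simp add: \<Lambda>_def)
  define W where "W t = exp (2 * \<bar>\<Lambda> t\<bar>)" for t
  let ?S = "{0<..} :: real set"
  define C where "C = {h :: real \<Rightarrow> 'b. continuous_on ?S h \<and> (\<exists>B. \<forall>t\<in>?S. norm (h t) \<le> B * W t)}"
  have c\<Lambda>: "continuous_on ?S \<Lambda>"
    using \<Lambda> by (intro continuous_at_imp_continuous_on) (auto intro: DERIV_isCont)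
  have cW: "continuous_on ?S W" unfolding W_def by (intro continuous_intros c\<Lambda>)
  have W_ge: "W t = exp (2 * \<Lambda> t)" if "t \<ge> 1" for t
    using \<Lambda>_mono[of 1 t] that by (simp add: W_def \<Lambda>1)
  have W_le: "W t = exp (- 2 * \<Lambda> t)" if "0 < t" "t \<le> 1" for t
    using \<Lambda>_mono[of t 1] that by (simp add: W_def \<Lambda>1)
  \<comment> \<open>On either side of 1 the derivative of \<open>W / 2\<close> is \<open>L W\<close>
    up to sign, so integrating \<open>L D W\<close> away from 1 gives at most
    \<open>D / 2 * W\<close>. This is the contraction factor 1/2.\<close>
  have bound: "norm (K t) \<le> D / 2 * W t"
    if K: "\<And>s. s > 0 \<Longrightarrow> (K has_vector_derivative \<kappa> s) (at s)" and K1: "K 1 = 0" and "D \<ge> 0"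
      and \<kappa>: "\<And>s. s > 0 \<Longrightarrow> norm (\<kappa> s) \<le> L s * (D * W s)" and t: "t > 0" 
      for K \<kappa> :: "real \<Rightarrow> 'b" and t D :: real
  proof (cases "t \<ge> 1")
    case True
    have "norm (K t - K 1) \<le> D / 2 * exp (2 * \<Lambda> t) - D / 2 * exp (2 * \<Lambda> 1)"
      by (rule norm_increment_le[where f' = \<kappa> and \<phi>' = "\<lambda>s. L s * (D * W s)"])
        (use True K \<kappa> in \<open>auto intro!: derivative_eq_intros \<Lambda> simp flip: W_ge\<close>)
    then show ?thesis using \<open>D \<ge> 0\<close> True by (simp add: K1 \<Lambda>1 W_ge)
  next
    case False
    have "norm (K 1 - K t) \<le> - (D / 2 * exp (- 2 * \<Lambda> 1)) - - (D / 2 * exp (- 2 * \<Lambda> t))"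
      by (rule norm_increment_le[where f' = \<kappa> and \<phi>' = "\<lambda>s. L s * (D * W s)"])
        (use False t K \<kappa> in \<open>auto intro!: derivative_eq_intros \<Lambda> simp: W_le[symmetric, simplified]\<close>)
    then show ?thesis using \<open>D \<ge> 0\<close> False t by (simp add: K1 \<Lambda>1 W_le)
  qed
  define K where "K h = (SOME K. \<forall>t>0. (K has_vector_derivative f t (h t)) (at t))" for h
  define T where "T h t = y0 + (K h t - K h 1)" for h t
  have K: "(K h has_vector_derivative f t (h t)) (at t)" if "h \<in> C" "t > 0" for h t
  proof -
    have "\<exists>K. \<forall>t>0. (K has_vector_derivative f t (h t)) (at t)"
      using that(1) by (intro continuous_antiderivative_pos cf) (auto simp: C_def)
    from someI_ex[OF this, THEN spec, THEN mp, OF that(2)] show ?thesis by (simp only: K_def)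
  qed
  have T: "(T h has_vector_derivative f t (h t)) (at t)" if "h \<in> C" "t > 0" for h t
    unfolding T_def
    by (rule has_vector_derivative_eq_rhs, (rule derivative_intros K[OF that])+) simp
  have Wge1: "W t \<ge> 1" for t by (simp add: W_def)
  have T_C: "T h \<in> C" if h: "h \<in> C" for h
  proof -
    obtain B where B: "\<And>t. t > 0 \<Longrightarrow> norm (h t) \<le> B * W t"
      using h unfolding C_def by auto
    have B': "norm (h t) \<le> \<bar>B\<bar> * W t" if "t > 0" for t
      using B[OF that] Wge1[of t] by (smt (verit) mult_right_mono)
    have "norm (f t (h t)) \<le> L t * (\<bar>B\<bar> * W t)" if "t > 0" for t
      using lip[OF that, of "h t" 0] B'[OF that] L(2)[OF that]
      by (smt (verit) diff_zero f0 mult_left_mono)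
    then have "norm (T h t - y0) \<le> \<bar>B\<bar> / 2 * W t" if "t > 0" for t
      using that K[OF h] has_vector_derivative_diff[OF K[OF h] has_vector_derivative_const]
      by (intro bound[of _ "\<lambda>t. f t (h t)"]) (simp_all add: T_def)
    then have "norm (T h t) \<le> (\<bar>B\<bar> / 2 + norm y0) * W t" if "t > 0" for t
      using norm_triangle_ineq2[of "T h t" y0] Wge1[of t] that
        mult_left_mono[of 1 "W t" "norm y0"] by (smt (verit) norm_ge_zero distrib_right)
    moreover have "continuous_on ?S (T h)"
      using T[OF h] by (intro continuous_at_imp_continuous_on)
        (auto intro: has_vector_derivative_continuous)
    ultimately show ?thesis by (auto simp: C_def)
  qed
  have "\<exists>h\<in>C. \<forall>t\<in>?S. T h t = h t"
    unfolding C_def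
  proof (rule weighted_contraction_fixpoint[where i = exp and j = ln])
    fix g h :: "real \<Rightarrow> 'b" and D :: real and t :: real
    assume "g \<in> {h. continuous_on ?S h \<and> (\<exists>B. \<forall>t\<in>?S. norm (h t) \<le> B * W t)}"
      "h \<in> {h. continuous_on ?S h \<and> (\<exists>B. \<forall>t\<in>?S. norm (h t) \<le> B * W t)}"
    then have gh: "g \<in> C" "h \<in> C" by (auto simp: C_def)
    assume D: "D \<ge> 0" "\<And>t. t \<in> ?S \<Longrightarrow> norm (g t - h t) \<le> D * W t" and t: "t \<in> ?S"
    have "norm (f s (g s) - f s (h s)) \<le> L s * (D * W s)" if "s > 0" for s
      using lip[OF that, of "g s" "h s"] D(2)[of s] L(2)[OF that] that
      by (smt (verit) greaterThan_iff mult_left_mono)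
    then show "norm (T g t - T h t) \<le> D / 2 * W t"
      using t D(1) has_vector_derivative_diff[OF T[OF gh(1)] T[OF gh(2)]]
      by (intro bound[of _ "\<lambda>t. f t (g t) - f t (h t)"]) (simp_all add: T_def)
  next
    show "range (exp :: real \<Rightarrow> real) \<subseteq> ?S" by auto
    show "continuous_on ?S W" by (rule cW)
    show "continuous_on ?S ln" by (intro continuous_intros) auto
    show "W t > 0" for t by (simp add: W_def)
  qed (use T_C in \<open>simp_all add: C_def continuous_on_exp\<close>)
  then obtain h where h: "h \<in> C" "\<And>t. t > 0 \<Longrightarrow> T h t = h t" by auto
  have "T h 1 = y0" by (simp add: T_def)
  moreover have "(T h has_vector_derivative f t (T h t)) (at t)" if "t > 0" for t
    using T[OF h(1) that] h(2)[OF that] by simp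
  ultimately show ?thesis by blast
qed

section \<open>The Volterra equation of WKB approximation\<close>

text \<open>Encodes that \<open>\<delta> t\<close> is the integral of \<open>\<delta>1\<close> from
  \<open>t\<close> to infinity, by derivative and limit instead of an improper integral.\<close>

locale tail_majorant =
  fixes X :: real and \<delta> \<delta>1 :: "real \<Rightarrow> real"
  assumes deriv: "\<And>t. t \<ge> X \<Longrightarrow> (\<delta> has_real_derivative - \<delta>1 t) (at t)"
    and lim: "(\<delta> \<longlongrightarrow> 0) at_top"
    and nonneg: "\<And>t. t \<ge> X \<Longrightarrow> \<delta>1 t \<ge> 0"
begin

lemma restrict: "Y \<ge> X \<Longrightarrow> tail_majorant Y \<delta> \<delta>1"
  using deriv lim nonneg by unfold_locales auto

lemma antimono: "X \<le> s \<Longrightarrow> s \<le> t \<Longrightarrow> \<delta> t \<le> \<delta> s"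
proof (rule DERIV_nonpos_imp_nonincreasing[where f = \<delta>])
  fix x assume "X \<le> s" "s \<le> x"
  then show "\<exists>y. (\<delta> has_real_derivative y) (at x) \<and> y \<le> 0"
    using deriv[of x] nonneg[of x] by auto
qed

lemma delta_nonneg: "t \<ge> X \<Longrightarrow> \<delta> t \<ge> 0"
  by (rule tendsto_upperbound[OF lim])
    (simp_all add: eventually_mono[OF eventually_ge_at_top[of t]] antimono)

lemma increment_bound:
  fixes F :: "real \<Rightarrow> 'a::real_normed_vector"
  assumes F: "\<And>t. t \<ge> X \<Longrightarrow> (F has_vector_derivative \<kappa> t) (at t)"
    and \<kappa>: "\<And>t. t \<ge> X \<Longrightarrow> norm (\<kappa> t) \<le> D * \<delta>1 t"
    and "X \<le> s" "s \<le> t"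
  shows "norm (F t - F s) \<le> D * \<delta> s - D * \<delta> t"
proof -
  have "norm (F t - F s) \<le> - (D * \<delta> t) - - (D * \<delta> s)"
    using assms by (intro norm_increment_le[where f' = \<kappa> and \<phi>' = "\<lambda>t. D * \<delta>1 t"])
      (auto intro!: derivative_eq_intros deriv)
  then show ?thesis by simp
qed

lemma tail_bound:
  fixes F :: "real \<Rightarrow> 'a::real_normed_vector"
  assumes F: "\<And>t. t \<ge> X \<Longrightarrow> (F has_vector_derivative \<kappa> t) (at t)"
    and \<kappa>: "\<And>t. t \<ge> X \<Longrightarrow> norm (\<kappa> t) \<le> D * \<delta>1 t"
    and F0: "(F \<longlongrightarrow> 0) at_top" and t: "t \<ge> X"
  shows "norm (F t) \<le> D * \<delta> t"
proof -
  have "((\<lambda>b. norm (F b - F t)) \<longlongrightarrow> norm (0 - F t)) at_top"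
    by (intro tendsto_intros F0)
  moreover have "((\<lambda>b. D * \<delta> t - D * \<delta> b) \<longlongrightarrow> D * \<delta> t - D * 0) at_top"
    by (intro tendsto_intros lim)
  moreover have "\<forall>\<^sub>F b in at_top. norm (F b - F t) \<le> D * \<delta> t - D * \<delta> b"
    using eventually_ge_at_top[of t]
    by eventually_elim (rule increment_bound[OF F \<kappa> t])
  ultimately have "norm (0 - F t) \<le> D * \<delta> t - D * 0"
    by (intro tendsto_le[OF trivial_limit_at_top_linorder])
  then show ?thesis by simp
qed

text \<open>Beyond \<open>s\<close> any antiderivative varies by at most
  \<open>D * \<delta> s\<close>, so it is Cauchy. Its limit is first taken along the integers; the
  same bound extends it to the real variable, and subtracting it normalises the antiderivative at
  infinity.\<close>

lemma tail_exists:
  fixes \<kappa> :: "real \<Rightarrow> 'a::euclidean_space"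
  assumes c: "continuous_on UNIV \<kappa>"
    and \<kappa>: "\<And>t. t \<ge> X \<Longrightarrow> norm (\<kappa> t) \<le> D * \<delta>1 t" and "D \<ge> 0"
  shows "\<exists>F. (\<forall>t. (F has_vector_derivative \<kappa> t) (at t)) \<and> (F \<longlongrightarrow> 0) at_top"
proof -
  obtain F where F: "\<And>t. (F has_vector_derivative \<kappa> t) (at t)"
    using continuous_antiderivative_real[OF c] by auto
  have inc: "norm (F t - F s) \<le> D * \<delta> s" if "X \<le> s" "s \<le> t" for s t
    using increment_bound[OF F \<kappa>, OF _ that] delta_nonneg[of t] that \<open>D \<ge> 0\<close>
    by (smt (verit) mult_nonneg_nonneg)
  have limD: "((\<lambda>t. D * \<delta> t) \<longlongrightarrow> 0) at_top"
    using tendsto_mult_right_zero[OF lim] by simp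
  have "Cauchy (\<lambda>n. F (real n))"
  proof (rule metric_CauchyI)
    fix e :: real assume "e > 0"
    then have "\<forall>\<^sub>F t in at_top. D * \<delta> t < e / 2"
      using limD by (intro order_tendstoD(2)[where y = 0]) auto
    then have "\<forall>\<^sub>F t in at_top. D * \<delta> t < e / 2 \<and> t \<ge> X"
      using eventually_ge_at_top by (rule eventually_conj)
    then obtain M where M: "\<And>t. t \<ge> M \<Longrightarrow> D * \<delta> t < e / 2 \<and> t \<ge> X"
      unfolding eventually_at_top_linorder by blast
    obtain N :: nat where N: "real N \<ge> M" using real_arch_simple by blast
    have "dist (F (real n)) (F (real N)) < e / 2" if "n \<ge> N" for n
      using inc[of "real N" "real n"] M[OF N] that by (simp add: dist_norm)
    then show "\<exists>M. \<forall>m\<ge>M. \<forall>n\<ge>M. dist (F (real m)) (F (real n)) < e"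
      by (meson dist_triangle_half_l)
  qed
  then obtain l where l: "(\<lambda>n. F (real n)) \<longlonglongrightarrow> l"
    using Cauchy_convergent convergent_def by blast
  have "norm (F t - l) \<le> D * \<delta> t" if "t \<ge> X" for t
  proof -
    have "(\<lambda>n. norm (F (real n) - F t)) \<longlonglongrightarrow> norm (l - F t)"
      by (intro tendsto_intros l)
    moreover have "\<forall>\<^sub>F n in sequentially. norm (F (real n) - F t) \<le> D * \<delta> t"
      using eventually_ge_at_top[of "nat \<lceil>t\<rceil>"]
      by eventually_elim (use that real_nat_ceiling_ge[of t] in \<open>auto intro!: inc\<close>)
    ultimately have "norm (l - F t) \<le> D * \<delta> t"
      by (intro tendsto_upperbound) auto
    then show ?thesis by (simp add: norm_minus_commute)
  qed
  then have "\<forall>\<^sub>F t in at_top. norm (F t - l) \<le> D * \<delta> t"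
    using eventually_ge_at_top[of X] by (rule eventually_mono[rotated])
  then have "((\<lambda>t. F t - l) \<longlongrightarrow> 0) at_top"
    by (rule Lim_null_comparison[OF _ limD])
  moreover have "((\<lambda>t. F t - l) has_vector_derivative \<kappa> t) (at t)" for t
    using has_vector_derivative_diff[OF F has_vector_derivative_const, of l] by simp
  ultimately show ?thesis by (intro exI[of _ "\<lambda>t. F t - l"]) simp
qed

text \<open>The integrated form is \<open>h(x) = 1 + \<integral> k h - G(x) / exp (\<omega> x)\<close>, integrating from \<open>x\<close> to \<open>\<infinity>\<close>.
  If \<open>\<bar>exp \<omega>\<bar>\<close> decays, \<open>G\<close> is normalised at \<open>\<infinity>\<close>, otherwise at \<open>X\<close>. In the second case the growth
  condition says that \<open>\<bar>exp \<omega>\<bar> \<delta>1 \<le> (\<bar>exp \<omega>\<bar> \<delta>)'\<close>, which keeps the error of order \<open>\<delta>\<close>.\<close>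

proposition wkb_volterra:
  fixes k \<omega> \<omega>' :: "real \<Rightarrow> complex"
  assumes k: "continuous_on {X..} k" "\<And>t. t \<ge> X \<Longrightarrow> norm (k t) \<le> \<delta>1 t"
    and \<omega>: "\<And>t. t \<ge> X \<Longrightarrow> (\<omega> has_vector_derivative \<omega>' t) (at t)"
    and small: "\<delta> X \<le> 1 / 4"
    and dichotomy: "(\<forall>t\<ge>X. Re (\<omega>' t) \<le> 0) \<or> (\<forall>t\<ge>X. 2 * \<delta>1 t \<le> Re (\<omega>' t) * \<delta> t)"
  shows "\<exists>h G C. \<forall>t>X. (h has_vector_derivative \<omega>' t * G t / exp (\<omega> t)) (at t)
           \<and> (G has_vector_derivative - k t * exp (\<omega> t) * h t) (at t)
           \<and> norm (h t - 1) \<le> C * \<delta> t \<and> norm (G t / exp (\<omega> t)) \<le> C * \<delta> t"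
proof -
  let ?S = "{X..}"
  define C where "C = {h :: real \<Rightarrow> complex. continuous_on ?S h \<and> (\<exists>B. \<forall>t\<in>?S. norm (h t) \<le> B * 1)}"
  \<comment> \<open>Everything is continued to the left of \<open>X\<close> by its value at
    \<open>X\<close>, so that antiderivatives exist on the whole line.\<close>
  define k0 where "k0 t = k (max X t)" for t
  define E where "E t = exp (\<omega> (max X t))" for t
  define h0 where "h0 h t = h (max X t)" for h :: "real \<Rightarrow> complex" and t
  have cmax: "continuous_on UNIV (max X)" by (intro continuous_intros)
  have cext: "continuous_on UNIV (\<lambda>t. f (max X t))" if "continuous_on ?S f" for f :: "real \<Rightarrow> complex"
    by (rule continuous_on_compose2[OF that cmax]) auto
  have c\<omega>: "continuous_on ?S \<omega>"
    using \<omega> by (intro continuous_at_imp_continuous_on) (auto intro: has_vector_derivative_continuous)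
  have ck0: "continuous_on UNIV k0" unfolding k0_def by (intro cext k)
  have cE: "continuous_on UNIV E" unfolding E_def by (intro continuous_intros cext c\<omega>)
  have ch0: "continuous_on UNIV (h0 h)" if "h \<in> C" for h
    unfolding h0_def using that by (intro cext) (auto simp: C_def)
  define r where "r t = Re (\<omega> t)" for t
  have r: "(r has_real_derivative Re (\<omega>' t)) (at t)" if "t \<ge> X" for t
    using bounded_linear.has_vector_derivative[OF bounded_linear_Re \<omega>[OF that]]
    by (simp add: has_real_derivative_iff_has_vector_derivative r_def[abs_def])
  have normE: "norm (E t) = exp (r t)" if "t \<ge> X" for t
    using that by (simp add: E_def r_def)
  define decaying where "decaying \<longleftrightarrow> (\<forall>t\<ge>X. Re (\<omega>' t) \<le> 0)"
  \<comment> \<open>Both normalisations are linear conditions, hence inherited by differences; the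
    contraction estimate relies on this.\<close>
  define nrm where "nrm G = (if decaying then (G \<longlongrightarrow> 0) at_top else G X = 0)"
    for G :: "real \<Rightarrow> complex"
  have E_antimono: "norm (E t) \<le> norm (E s)" if decaying "X \<le> s" "s \<le> t" for s t
  proof -
    have "r t \<le> r s"
      by (rule DERIV_nonpos_imp_nonincreasing[OF that(3)])
        (use that r in \<open>meson decaying_def order_trans\<close>)
    then show ?thesis using that by (simp add: normE)
  qed
  have G_bound: "norm (G t) \<le> D * (norm (E t) * \<delta> t)"
    if G: "\<And>t. t \<ge> X \<Longrightarrow> (G has_vector_derivative \<gamma> t) (at t)" and n: "nrm G"
      and \<gamma>: "\<And>t. t \<ge> X \<Longrightarrow> norm (\<gamma> t) \<le> D * (norm (E t) * \<delta>1 t)"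
      and D: "D \<ge> 0" and t: "t \<ge> X" for G \<gamma> :: "real \<Rightarrow> complex" and D t :: real
  proof (cases decaying)
    case True
    interpret t: tail_majorant t \<delta> \<delta>1 by (rule restrict[OF t])
    \<comment> \<open>With the majorant restarted at \<open>t\<close>, the decaying factor
      \<open>norm (E s)\<close> is bounded by its value at \<open>t\<close> and leaves the tail
      integral, which is then \<open>\<delta> t\<close>.\<close>
    have "norm (\<gamma> s) \<le> (D * norm (E t)) * \<delta>1 s" if "s \<ge> t" for s
    proof -
      have "norm (E s) * \<delta>1 s \<le> norm (E t) * \<delta>1 s"
        by (intro mult_right_mono E_antimono True that t nonneg order_trans[OF t that])
      from order_trans[OF \<gamma>[OF order_trans[OF t that]] mult_left_mono[OF this D]]
      show ?thesis by (simp only: mult.assoc)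
    qed
    then show ?thesis
      using t.tail_bound[of G \<gamma> "D * norm (E t)" t] G n t True by (simp add: nrm_def mult.assoc)
  next
    case False
    then have dom: "2 * \<delta>1 t \<le> Re (\<omega>' t) * \<delta> t" if "t \<ge> X" for t
      using dichotomy that by (auto simp: decaying_def)
    have "norm (G t - G X) \<le> D * (exp (r t) * \<delta> t) - D * (exp (r X) * \<delta> X)"
    proof (rule norm_increment_le)
      fix s assume s: "X \<le> s"
      show "((\<lambda>s. D * (exp (r s) * \<delta> s)) has_real_derivative
          D * (exp (r s) * (Re (\<omega>' s) * \<delta> s - \<delta>1 s))) (at s)"
        by (auto intro!: derivative_eq_intros r deriv s simp: algebra_simps)
      have "norm (E s) * \<delta>1 s \<le> exp (r s) * (Re (\<omega>' s) * \<delta> s - \<delta>1 s)"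
        using dom[OF s] by (simp add: normE s)
      then show "norm (\<gamma> s) \<le> D * (exp (r s) * (Re (\<omega>' s) * \<delta> s - \<delta>1 s))"
        using \<gamma>[OF s] D by (meson mult_left_mono order_trans)
    qed (use t G in auto)
    moreover have "D * (exp (r X) * \<delta> X) \<ge> 0"
      using D delta_nonneg[of X] by simp
    ultimately show ?thesis using n False t by (simp add: nrm_def normE)
  qed
  have G_ex: "\<exists>G. (\<forall>t. (G has_vector_derivative \<gamma> t) (at t)) \<and> nrm G"
    if c: "continuous_on UNIV \<gamma>" and D: "D \<ge> 0"
      and \<gamma>: "\<And>t. t \<ge> X \<Longrightarrow> norm (\<gamma> t) \<le> D * (norm (E t) * \<delta>1 t)" for \<gamma> D
  proof (cases decaying)
    case True
    have "norm (\<gamma> t) \<le> (D * norm (E X)) * \<delta>1 t" if "t \<ge> X" for t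
    proof -
      have "norm (E t) * \<delta>1 t \<le> norm (E X) * \<delta>1 t"
        by (intro mult_right_mono E_antimono True that nonneg) simp
      from order_trans[OF \<gamma>[OF that] mult_left_mono[OF this D]]
      show ?thesis by (simp only: mult.assoc)
    qed
    from tail_exists[OF c this] D True show ?thesis by (simp add: nrm_def)
  next
    case False
    obtain G where G: "\<And>t. (G has_vector_derivative \<gamma> t) (at t)"
      using continuous_antiderivative_real[OF c] by auto
    have "((\<lambda>t. G t - G X) has_vector_derivative \<gamma> t) (at t)" for t
      using has_vector_derivative_diff[OF G has_vector_derivative_const, of "G X"] by simp
    then show ?thesis using False by (intro exI[of _ "\<lambda>t. G t - G X"]) (simp add: nrm_def)
  qed
  have nrm_diff: "nrm (\<lambda>t. G1 t - G2 t)" if "nrm G1" "nrm G2" for G1 G2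
    using that tendsto_diff[of G1 0 at_top G2 0] by (auto simp: nrm_def split: if_splits)

  have kh_bound: "norm (- k0 t * h0 h t) \<le> B * \<delta>1 t"
    "norm (- k0 t * E t * h0 h t) \<le> B * (norm (E t) * \<delta>1 t)"
    if "\<And>t. t \<in> ?S \<Longrightarrow> norm (h t) \<le> B" "t \<ge> X" for h B t
  proof -
    have *: "norm (k0 t) * norm (h0 h t) \<le> \<delta>1 t * B"
      using that k(2)[of t] nonneg[of t] by (intro mult_mono) (auto simp: k0_def h0_def)
    then show "norm (- k0 t * h0 h t) \<le> B * \<delta>1 t" by (simp add: norm_mult mult.commute)
    from mult_left_mono[OF *, of "norm (E t)"]
    show "norm (- k0 t * E t * h0 h t) \<le> B * (norm (E t) * \<delta>1 t)"
      by (simp add: norm_mult mult_ac)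
  qed
  have "\<exists>F G. (\<forall>t. (F has_vector_derivative - k0 t * h0 h t) (at t)) \<and> (F \<longlongrightarrow> 0) at_top
      \<and> (\<forall>t. (G has_vector_derivative - k0 t * E t * h0 h t) (at t)) \<and> nrm G"
    if h: "h \<in> C" for h
  proof -
    obtain B where B: "\<And>t. t \<in> ?S \<Longrightarrow> norm (h t) \<le> B" using h by (auto simp: C_def)
    have B0: "B \<ge> 0" using B[of X] by (smt (verit) atLeast_iff norm_ge_zero)
    have c: "continuous_on UNIV (\<lambda>t. - k0 t * h0 h t)" "continuous_on UNIV (\<lambda>t. - k0 t * E t * h0 h t)"
      by (intro continuous_intros ck0 cE ch0 h)+
    have "\<exists>F. (\<forall>t. (F has_vector_derivative - k0 t * h0 h t) (at t)) \<and> (F \<longlongrightarrow> 0) at_top"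
      by (rule tail_exists[OF c(1) kh_bound(1)[OF B] B0])
    then obtain F where "\<forall>t. (F has_vector_derivative - k0 t * h0 h t) (at t)" "(F \<longlongrightarrow> 0) at_top"
      by (elim exE conjE)
    moreover have "\<exists>G. (\<forall>t. (G has_vector_derivative - k0 t * E t * h0 h t) (at t)) \<and> nrm G"
      by (rule G_ex[OF c(2) B0 kh_bound(2)[OF B]])
    then obtain G where "\<forall>t. (G has_vector_derivative - k0 t * E t * h0 h t) (at t)" "nrm G"
      by (elim exE conjE)
    ultimately show ?thesis by (intro exI[of _ F] exI[of _ G]) simp
  qed
  then have "\<forall>h. \<exists>F G. h \<in> C \<longrightarrow> (\<forall>t. (F has_vector_derivative - k0 t * h0 h t) (at t)) \<and> (F \<longlongrightarrow> 0) at_top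
      \<and> (\<forall>t. (G has_vector_derivative - k0 t * E t * h0 h t) (at t)) \<and> nrm G"
    by simp
  then obtain F G where
    FG: "\<forall>h. h \<in> C \<longrightarrow> (\<forall>t. (F h has_vector_derivative - k0 t * h0 h t) (at t)) \<and> (F h \<longlongrightarrow> 0) at_top
      \<and> (\<forall>t. (G h has_vector_derivative - k0 t * E t * h0 h t) (at t)) \<and> nrm (G h)"
    unfolding choice_iff by (elim exE)
  then have
    F: "\<And>h t. h \<in> C \<Longrightarrow> (F h has_vector_derivative - k0 t * h0 h t) (at t)"
      "\<And>h. h \<in> C \<Longrightarrow> (F h \<longlongrightarrow> 0) at_top"
    and G: "\<And>h t. h \<in> C \<Longrightarrow> (G h has_vector_derivative - k0 t * E t * h0 h t) (at t)"
      "\<And>h. h \<in> C \<Longrightarrow> nrm (G h)"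
    by simp_all
  \<comment> \<open>Since \<open>G' = E * F'\<close>, the derivative of \<open>T h\<close> is
    \<open>\<omega>' * G h / E\<close>. This integration by parts keeps the possibly large factor
    \<open>\<omega>'\<close> out of every integrand that has to be estimated.\<close>
  define T where "T h t = 1 + F h t - G h t / E t" for h t
  have bound: "norm (T h t - 1) \<le> 2 * B * \<delta> t \<and> norm (G h t / E t) \<le> B * \<delta> t"
    if h: "h \<in> C" and B: "\<And>t. t \<in> ?S \<Longrightarrow> norm (h t) \<le> B" and t: "t \<ge> X" for h B t
  proof -
    have B0: "B \<ge> 0" using B[of X] by (smt (verit) atLeast_iff norm_ge_zero)
    have "norm (F h t) \<le> B * \<delta> t"
      by (rule tail_bound[OF F(1)[OF h] kh_bound(1)[OF B] F(2)[OF h] t])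
    moreover have "norm (G h t) \<le> B * (norm (E t) * \<delta> t)"
      by (rule G_bound[OF G(1)[OF h] G(2)[OF h] kh_bound(2)[OF B] B0 t])
    then have *: "norm (G h t / E t) \<le> B * \<delta> t"
      by (simp add: norm_divide E_def field_simps)
    ultimately show ?thesis
      using norm_triangle_ineq4[of "F h t" "G h t / E t"] by (simp add: T_def)
  qed
  have ET: "E t \<noteq> 0" for t by (simp add: E_def)
  have cont_hvd: "continuous_on A f" if "\<And>t. (f has_vector_derivative f' t) (at t)"
    for A and f f' :: "real \<Rightarrow> complex"
    using that by (intro continuous_at_imp_continuous_on) (auto intro: has_vector_derivative_continuous)
  have T_C: "T h \<in> C" if h: "h \<in> C" for h
  proof -
    obtain B where B: "\<And>t. t \<in> ?S \<Longrightarrow> norm (h t) \<le> B" using h by (auto simp: C_def)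
    have B0: "B \<ge> 0" using B[of X] by (smt (verit) atLeast_iff norm_ge_zero)
    have "norm (T h t) \<le> 1 + 2 * B * \<delta> X" if "t \<in> ?S" for t
    proof -
      have "2 * B * \<delta> t \<le> 2 * B * \<delta> X"
        using antimono[of X t] that B0 by (intro mult_left_mono) auto
      then show ?thesis
        using bound[OF h B, of t] that norm_triangle_ineq2[of "T h t" 1] by simp
    qed
    moreover have "continuous_on ?S (T h)"
      unfolding T_def using ET
      by (intro continuous_intros cont_hvd[OF F(1)[OF h]] cont_hvd[OF G(1)[OF h]]
          continuous_on_subset[OF cE]) auto
    ultimately show ?thesis by (auto simp: C_def)
  qed
  have "\<exists>h\<in>C. \<forall>t\<in>?S. T h t = h t"
    unfolding C_def
  proof (rule weighted_contraction_fixpoint[where i = "max X" and j = "\<lambda>t. t"])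
    fix g h :: "real \<Rightarrow> complex" and D t :: real
    assume "g \<in> {h. continuous_on ?S h \<and> (\<exists>B. \<forall>t\<in>?S. norm (h t) \<le> B * 1)}"
      "h \<in> {h. continuous_on ?S h \<and> (\<exists>B. \<forall>t\<in>?S. norm (h t) \<le> B * 1)}"
    then have gh: "g \<in> C" "h \<in> C" by (auto simp: C_def)
    assume D: "D \<ge> 0" "\<And>t. t \<in> ?S \<Longrightarrow> norm (g t - h t) \<le> D * 1" and t: "t \<in> ?S"
    have diff: "norm (g t - h t) \<le> D" if "t \<in> ?S" for t using D(2)[OF that] by simp
    have Xt: "X \<le> t" using t by simp
    have b: "norm (- k0 t * h0 g t - - k0 t * h0 h t) \<le> D * \<delta>1 t"
      "norm (- k0 t * E t * h0 g t - - k0 t * E t * h0 h t) \<le> D * (norm (E t) * \<delta>1 t)"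
      if "t \<ge> X" for t
      using kh_bound[of "\<lambda>t. g t - h t" D t] diff that by (simp_all add: h0_def algebra_simps)
    have "norm (F g t - F h t) \<le> D * \<delta> t"
      by (rule tail_bound[OF has_vector_derivative_diff[OF F(1)[OF gh(1)] F(1)[OF gh(2)]] b(1) _ Xt])
        (use tendsto_diff[OF F(2)[OF gh(1)] F(2)[OF gh(2)]] in auto)
    moreover have "norm (G g t - G h t) \<le> D * (norm (E t) * \<delta> t)"
      by (rule G_bound[OF has_vector_derivative_diff[OF G(1)[OF gh(1)] G(1)[OF gh(2)]]
            nrm_diff[OF G(2)[OF gh(1)] G(2)[OF gh(2)]] b(2) D(1) Xt])
    then have "norm ((G g t - G h t) / E t) \<le> D * \<delta> t"
      by (simp add: norm_divide E_def field_simps)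
    \<comment> \<open>The \<open>F\<close> and the \<open>G\<close> contribution are each at most
      \<open>D / 4\<close>, which together give the factor 1/2; hence the threshold in
      \<open>small\<close>.\<close>
    moreover have "D * \<delta> t \<le> D * (1 / 4)"
      using antimono[of X t] small Xt D(1) by (intro mult_left_mono) auto
    moreover have "T g t - T h t = (F g t - F h t) - (G g t - G h t) / E t"
      by (simp add: T_def diff_divide_distrib)
    ultimately show "norm (T g t - T h t) \<le> D / 2 * 1"
      using norm_triangle_ineq4[of "F g t - F h t" "(G g t - G h t) / E t"] by simp
  next
    show "continuous_on UNIV (max X)" by (rule cmax)
  qed (use T_C in \<open>auto simp: C_def\<close>)
  then obtain h where h: "h \<in> C" and Th: "\<And>t. t \<ge> X \<Longrightarrow> T h t = h t" by auto
  obtain B where B: "\<And>t. t \<in> ?S \<Longrightarrow> norm (h t) \<le> B" using h by (auto simp: C_def)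
  have B0: "B \<ge> 0" using B[of X] by (smt (verit) atLeast_iff norm_ge_zero)
  show ?thesis
  proof (intro exI allI impI conjI)
    fix t assume t: "t > X"
    have E_t: "E t = exp (\<omega> t)" using t by (simp add: E_def)
    have "(E has_vector_derivative \<omega>' t * E t) (at t)"
    proof (rule has_vector_derivative_transform_within_open[of "\<lambda>t. exp (\<omega> t)" _ _ "{X<..}"])
      show "((\<lambda>t. exp (\<omega> t)) has_vector_derivative \<omega>' t * E t) (at t)"
        using field_vector_diff_chain_at[OF \<omega>[of t] DERIV_exp] t by (simp add: o_def E_t)
    qed (use t in \<open>auto simp: E_def\<close>)
    then have "(T h has_vector_derivative \<omega>' t * G h t / E t) (at t)"
      unfolding T_def
      using ET[of t] by (intro has_vector_derivative_eq_rhs[OF has_vector_derivative_diff[OF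
          has_vector_derivative_add[OF has_vector_derivative_const F(1)[OF h]]
          has_vector_derivative_quotient[OF G(1)[OF h] _ ET]]])
        (auto simp: power2_eq_square field_simps)
    then show "(h has_vector_derivative \<omega>' t * G h t / exp (\<omega> t)) (at t)"
      unfolding E_t by (rule has_vector_derivative_transform_within_open[of _ _ _ "{X<..}"])
        (use t Th in auto)
    show "(G h has_vector_derivative - k t * exp (\<omega> t) * h t) (at t)"
      using G(1)[OF h, of t] t by (simp add: k0_def h0_def E_def)
    have "0 \<le> \<delta> t" using delta_nonneg t by simp
    then have "B * \<delta> t \<le> 2 * B * \<delta> t" using B0 by (simp add: mult_right_mono)
    then show "norm (h t - 1) \<le> 2 * B * \<delta> t" "norm (G h t / exp (\<omega> t)) \<le> 2 * B * \<delta> t"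
      using bound[OF h B, of t] t by (auto simp: Th E_t)
  qed
qed

end

section \<open>The coefficient function\<close>

lemma erf_has_real_derivative: "(erf has_real_derivative 2 / sqrt pi * exp (- x\<^sup>2)) (at x)"
proof -
  let ?a = "min 0 x - 1" and ?b = "max 0 x + 1"
  have "((\<lambda>u. LBINT s=0..u. exp (- s\<^sup>2)) has_vector_derivative exp (- x\<^sup>2)) (at x within {?a..?b})"
    using interval_integral_FTC2[of ?a 0 ?b "\<lambda>s. exp (- s\<^sup>2)" x]
    by (simp add: zero_ereal_def continuous_intros)
  then have "((\<lambda>u. LBINT s=0..u. exp (- s\<^sup>2)) has_real_derivative exp (- x\<^sup>2)) (at x)"
    by (simp add: has_real_derivative_iff_has_vector_derivative at_within_Icc_at)
  from DERIV_cmult[OF this, of "2 / sqrt pi"] show ?thesis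
    unfolding erf_def[abs_def] by simp
qed

lemma erf_tendsto_1: "(erf \<longlongrightarrow> 1) at_top"
proof -
  let ?f = "\<lambda>x :: real. exp (- x\<^sup>2)"
  have int: "set_integrable lborel {0..} ?f"
    and val: "set_lebesgue_integral lborel {0..} ?f = sqrt pi / 2"
    using gaussian_moment_0
    by (auto simp: set_integrable_def set_lebesgue_integral_def has_bochner_integral_iff)
  have "((\<lambda>b. set_lebesgue_integral lborel {0..b} ?f) \<longlongrightarrow> sqrt pi / 2) at_top"
    using tendsto_set_lebesgue_integral_at_top[OF _ int] by (simp add: val)
  then have "((\<lambda>b. 2 / sqrt pi * set_lebesgue_integral lborel {0..b} ?f) \<longlongrightarrow> 2 / sqrt pi * (sqrt pi / 2)) at_top"
    by (intro tendsto_intros)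
  then have *: "((\<lambda>b. 2 / sqrt pi * set_lebesgue_integral lborel {0..b} ?f) \<longlongrightarrow> 1) at_top" by simp
  have "2 / sqrt pi * set_lebesgue_integral lborel {0..b} ?f = erf b" if "b \<ge> 0" for b
    using interval_integral_Icc[OF that, of ?f] by (simp add: erf_def zero_ereal_def)
  then have "\<forall>\<^sub>F b in at_top. 2 / sqrt pi * set_lebesgue_integral lborel {0..b} ?f = erf b"
    by (intro eventually_mono[OF eventually_ge_at_top[of 0]])
  from Lim_transform_eventually[OF * this] show ?thesis .
qed

section \<open>The numerator of \<open>Psi\<close> and its rapid approach to 1\<close>

definition psi_num :: "real \<Rightarrow> real" where
  "psi_num x = erf x - 2 / sqrt pi * x * exp (- x\<^sup>2)"

definition psi_num1 :: "real \<Rightarrow> real" where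
  "psi_num1 x = 4 / sqrt pi * x\<^sup>2 * exp (- x\<^sup>2)"

definition psi_num2 :: "real \<Rightarrow> real" where
  "psi_num2 x = 4 / sqrt pi * ((2 * x - 2 * x ^ 3) * exp (- x\<^sup>2))"

text \<open>The derivative of \<open>erf\<close> cancels against part of the product rule. So
  \<open>psi_num\<close> is the integral of \<open>4 / sqrt pi * s^2 * exp (- s^2)\<close> from 0,
  the Maxwell speed distribution function, which increases from 0 to 1.\<close>

lemma psi_num_deriv: "(psi_num has_real_derivative psi_num1 x) (at x)"
  unfolding psi_num_def[abs_def] psi_num1_def
  by (auto intro!: derivative_eq_intros erf_has_real_derivative simp: field_simps power2_eq_square)

lemma psi_num1_deriv: "(psi_num1 has_real_derivative psi_num2 x) (at x)"
proof -
  have "((\<lambda>x. x\<^sup>2 * exp (- x\<^sup>2)) has_real_derivative (2 * x - 2 * x ^ 3) * exp (- x\<^sup>2)) (at x)"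
    by (auto intro!: derivative_eq_intros simp: algebra_simps power2_eq_square power3_eq_cube)
  from DERIV_cmult[OF this, of "4 / sqrt pi"] show ?thesis
    unfolding psi_num1_def[abs_def] psi_num2_def mult.assoc .
qed

lemma psi_num_pos:
  assumes "x > 0"
  shows "psi_num x > 0"
proof -
  have "psi_num 0 < psi_num x"
    by (rule DERIV_pos_imp_increasing_open[OF assms])
      (auto intro!: exI[of _ "psi_num1 _"] psi_num_deriv DERIV_isCont continuous_at_imp_continuous_on
        simp: psi_num1_def)
  then show ?thesis by (simp add: psi_num_def erf_def zero_ereal_def)
qed

lemma psi_num_tendsto_1: "(psi_num \<longlongrightarrow> 1) at_top"
proof -
  have "((\<lambda>x. 2 / sqrt pi * x * exp (- x\<^sup>2)) \<longlongrightarrow> 0) at_top" by real_asymp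
  from tendsto_diff[OF erf_tendsto_1 this] show ?thesis by (simp add: psi_num_def[abs_def])
qed

lemma psi_num1_small: "((\<lambda>x. x ^ 8 * psi_num1 x) \<longlongrightarrow> 0) at_top"
  unfolding psi_num1_def by real_asymp

text \<open>The difference is in fact exponentially small. The power 6 is what the residual asks
  for, where the coefficient \<open>2 lam x^3\<close> is scaled by another \<open>x^3\<close>. The
  proof integrates the crude bound \<open>x^-8\<close> for the derivative, which leaves one power of
  \<open>x\<close> to spare.\<close>

lemma psi_num_small: "((\<lambda>x. x ^ 6 * (1 - psi_num x)) \<longlongrightarrow> 0) at_top"
proof -
  have "\<forall>\<^sub>F x in at_top. x ^ 8 * psi_num1 x < 1 \<and> x > (0::real)"
    by (intro eventually_conj order_tendstoD(2)[OF psi_num1_small] eventually_gt_at_top) simp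
  then obtain X where X: "\<And>x. x \<ge> X \<Longrightarrow> x ^ 8 * psi_num1 x < 1 \<and> x > 0"
    unfolding eventually_at_top_linorder by blast
  interpret tail_majorant X "\<lambda>x. inverse (x ^ 7) / 7" "\<lambda>x. inverse (x ^ 8)"
  proof
    fix t assume "t \<ge> X"
    then have "t > 0" using X by auto
    then show "((\<lambda>x. inverse (x ^ 7) / 7) has_real_derivative - inverse (t ^ 8)) (at t)"
      by (auto intro!: derivative_eq_intros simp: field_simps eval_nat_numeral)
    show "0 \<le> inverse (t ^ 8)" using \<open>t > 0\<close> by simp
  next
    show "((\<lambda>x. inverse (x ^ 7) / 7 :: real) \<longlongrightarrow> 0) at_top" by real_asymp
  qed
  have dist1: "norm (psi_num t - 1) \<le> 1 * (inverse (t ^ 7) / 7)" if "t \<ge> X" for t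
  proof (rule tail_bound[OF _ _ _ that])
    show "((\<lambda>t. psi_num t - 1) has_vector_derivative psi_num1 t) (at t)" for t
      using DERIV_diff[OF psi_num_deriv DERIV_const]
      by (simp add: has_real_derivative_iff_has_vector_derivative)
    fix t assume "t \<ge> X"
    from X[OF this] show "norm (psi_num1 t) \<le> 1 * inverse (t ^ 8)"
      by (simp add: psi_num1_def field_simps)
  next
    show "((\<lambda>t. psi_num t - 1) \<longlongrightarrow> 0) at_top"
      using tendsto_diff[OF psi_num_tendsto_1 tendsto_const[of 1]] by simp
  qed
  have "norm (x ^ 6 * (1 - psi_num x)) \<le> 1 / x" if "x \<ge> X" for x
  proof -
    have "norm (x ^ 6 * (1 - psi_num x)) = x ^ 6 * norm (psi_num x - 1)"
      by (simp add: abs_mult abs_minus_commute)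
    also have "\<dots> \<le> x ^ 6 * (inverse (x ^ 7) / 7)"
      using that X[OF that] dist1[of x] by (intro mult_left_mono) auto
    also have "\<dots> \<le> 1 / x"
      using X[OF that] by (simp add: field_simps eval_nat_numeral)
    finally show ?thesis .
  qed
  then have "\<forall>\<^sub>F x in at_top. norm (x ^ 6 * (1 - psi_num x)) \<le> 1 / x"
    by (rule eventually_mono[OF eventually_ge_at_top[of X]])
  moreover have "((\<lambda>x. 1 / x :: real) \<longlongrightarrow> 0) at_top" by real_asymp
  ultimately show ?thesis by (rule Lim_null_comparison)
qed

definition psi_log1 :: "real \<Rightarrow> real" where
  "psi_log1 x = psi_num1 x / psi_num x"

definition psi_log2 :: "real \<Rightarrow> real" where
  "psi_log2 x = psi_num2 x / psi_num x - (psi_num1 x / psi_num x)\<^sup>2"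

lemma psi_log1_deriv:
  assumes "x > 0"
  shows "(psi_log1 has_real_derivative psi_log2 x) (at x)"
  unfolding psi_log1_def[abs_def] psi_log2_def
  using psi_num_pos[OF assms]
  by (auto intro!: derivative_eq_intros psi_num_deriv psi_num1_deriv
      simp: field_simps power2_eq_square)

text \<open>These are the four products in which the logarithmic derivative of
  \<open>psi_num\<close> and its derivative enter \<open>x^3 * N x\<close>.\<close>

lemma psi_log_small:
  "((\<lambda>x. x\<^sup>2 * psi_log1 x) \<longlongrightarrow> 0) at_top"
  "((\<lambda>x. x ^ 4 * psi_log1 x) \<longlongrightarrow> 0) at_top"
  "((\<lambda>x. x ^ 3 * (psi_log1 x)\<^sup>2) \<longlongrightarrow> 0) at_top"
  "((\<lambda>x. x ^ 3 * psi_log2 x) \<longlongrightarrow> 0) at_top"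
proof -
  have *: "((\<lambda>x. f x / psi_num x) \<longlongrightarrow> 0) at_top" if "(f \<longlongrightarrow> 0) at_top" for f
    using tendsto_divide[OF that psi_num_tendsto_1] by simp
  show 2: "((\<lambda>x. x\<^sup>2 * psi_log1 x) \<longlongrightarrow> 0) at_top"
    unfolding psi_log1_def times_divide_eq_right by (rule *, unfold psi_num1_def) real_asymp
  show "((\<lambda>x. x ^ 4 * psi_log1 x) \<longlongrightarrow> 0) at_top"
    unfolding psi_log1_def times_divide_eq_right by (rule *, unfold psi_num1_def) real_asymp
  have "((\<lambda>x. inverse x * (x\<^sup>2 * psi_log1 x)\<^sup>2) \<longlongrightarrow> 0 * 0\<^sup>2) at_top"
    by (intro tendsto_intros 2 tendsto_inverse_0_at_top filterlim_ident)
  moreover have "\<forall>\<^sub>F x in at_top. inverse x * (x\<^sup>2 * psi_log1 x)\<^sup>2 = x ^ 3 * (psi_log1 x)\<^sup>2"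
    using eventually_gt_at_top[of 0] by eventually_elim (simp add: field_simps eval_nat_numeral)
  ultimately show 3: "((\<lambda>x. x ^ 3 * (psi_log1 x)\<^sup>2) \<longlongrightarrow> 0) at_top"
    by (simp add: tendsto_cong)
  have "((\<lambda>x. x ^ 3 * psi_num2 x / psi_num x - x ^ 3 * (psi_log1 x)\<^sup>2) \<longlongrightarrow> 0 - 0) at_top"
    by (intro tendsto_diff 3 *, unfold psi_num2_def, real_asymp)
  then show "((\<lambda>x. x ^ 3 * psi_log2 x) \<longlongrightarrow> 0) at_top"
    by (simp add: psi_log1_def psi_log2_def algebra_simps)
qed

lemma Psi_weight:
  assumes "x > 0"
  shows "Psi x * weight x = psi_num x * exp (- x\<^sup>2) / (2 * x)"
  using assms by (simp add: Psi_def weight_def psi_num_def field_simps eval_nat_numeral)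

lemma Psi_weight_pos: "x > 0 \<Longrightarrow> Psi x * weight x > 0"
  using psi_num_pos[of x] by (simp add: Psi_weight)

lemma Psi_weight_deriv:
  assumes "x > 0"
  shows "((\<lambda>x. Psi x * weight x) has_real_derivative
    (- 2 * x - 1 / x + psi_log1 x) * (Psi x * weight x)) (at x)"
proof -
  have "((\<lambda>x. psi_num x * exp (- x\<^sup>2) / (2 * x)) has_real_derivative
      (- 2 * x - 1 / x + psi_log1 x) * (psi_num x * exp (- x\<^sup>2) / (2 * x))) (at x)"
    using assms psi_num_pos[OF assms] unfolding psi_log1_def
    by (auto intro!: derivative_eq_intros psi_num_deriv simp: field_simps power2_eq_square)
  then show ?thesis
    unfolding Psi_weight[OF assms, symmetric]
    by (rule has_field_derivative_transform_within_open[of _ _ _ "{0<..}"])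
      (use assms in \<open>auto simp: Psi_weight\<close>)
qed

section \<open>Phase, amplitude and residual\<close>

lemma inverse_power_deriv:
  assumes "z \<noteq> 0"
  shows "((\<lambda>z. c / z ^ n) has_field_derivative - (of_nat n * c / z ^ Suc n)) (at (z :: complex))"
proof -
  have "((\<lambda>z. c * inverse z ^ n) has_field_derivative - (of_nat n * c * inverse z ^ Suc n)) (at z)"
    using DERIV_cmult[OF DERIV_power[OF DERIV_inverse[OF assms], of n], of c]
    by (cases n) (simp_all add: algebra_simps)
  then show ?thesis by (simp add: divide_inverse power_inverse)
qed

text \<open>Degree 6, although \<open>q\<close> and \<open>P1\<close> stop at 5, so that the same
  statement also differentiates \<open>q1\<close>.\<close>

lemma inverse_polynomial_deriv:
  fixes d0 d1 d2 d3 d4 d5 d6 :: complex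
  assumes "x \<noteq> 0"
  shows "((\<lambda>x. d0 + d1 / of_real x + d2 / of_real x ^ 2 + d3 / of_real x ^ 3 + d4 / of_real x ^ 4
      + d5 / of_real x ^ 5 + d6 / of_real x ^ 6)
    has_vector_derivative - (d1 / of_real x ^ 2 + 2 * d2 / of_real x ^ 3 + 3 * d3 / of_real x ^ 4
      + 4 * d4 / of_real x ^ 5 + 5 * d5 / of_real x ^ 6 + 6 * d6 / of_real x ^ 7)) (at x)"
    (is "(_ has_vector_derivative ?D) _")
proof -
  have "((\<lambda>z. d0 + d1 / z ^ 1 + d2 / z ^ 2 + d3 / z ^ 3 + d4 / z ^ 4 + d5 / z ^ 5 + d6 / z ^ 6)
      has_field_derivative ?D) (at (complex_of_real x))"
    using assms by (auto intro!: derivative_eq_intros inverse_power_deriv simp: numeral_eq_Suc mult_ac)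
  from has_vector_derivative_real_field[OF this] show ?thesis by simp
qed

lemma has_vector_derivative_exp:
  assumes "(f has_vector_derivative f') (at x)"
  shows "((\<lambda>x. exp (f x :: complex)) has_vector_derivative f' * exp (f x)) (at x)"
  using field_vector_diff_chain_at[OF assms DERIV_exp] by (simp add: o_def)

lemma of_real_inverse_tendsto: "((\<lambda>x. inverse (of_real x) :: complex) \<longlongrightarrow> 0) at_top"
  using tendsto_of_real[OF tendsto_inverse_0_at_top[OF filterlim_ident], where 'a = complex] by simp

section \<open>The truncated phase and its residual\<close>

locale nonzero_eigenvalue =
  fixes lam :: complex
  assumes lam: "lam \<noteq> 0"
begin

text \<open>Leading coefficient of \<open>\<theta>'\<close>; the 5/2 comes from differentiating
  \<open>x^(5/2)\<close>. Its square does not see the branch of the root.\<close>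

definition a where "a = 5 / 2 * csqrt (8 * lam / 25)"

lemma a_squared: "a\<^sup>2 = 2 * lam"
  by (simp add: a_def power_mult_distrib power_divide)

lemma a_nonzero: "a \<noteq> 0"
  using a_squared lam by auto

text \<open>Differentiating \<open>x^(5/2 - j)\<close> multiplies the coefficient of
  \<open>x^-j\<close> in \<open>P1\<close> by \<open>1 - 2 j / 5\<close>, which yields
  \<open>b1\<close> to \<open>b5\<close>.\<close>

definition b1 where "b1 = - 1 / (4 * lam)"
definition b2 where "b2 = - 1 / (32 * lam\<^sup>2)"
definition b3 where "b3 = - 1 / (128 * lam ^ 3)"
definition b4 where "b4 = - 5 / (2048 * lam ^ 4)"
definition b5 where "b5 = - (7 - 1152 * lam ^ 4) / (8192 * lam ^ 5)"

lemmas b_defs = b1_def b2_def b3_def b4_def b5_def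

text \<open>Comparison of the coefficients of \<open>x^-1\<close> to \<open>x^-5\<close> in
  \<open>2 lam q^2 = 2 lam - 1/x + 9/(16 x^5)\<close>.\<close>

lemma b_relations:
  "2 * lam * (2 * b1) = - 1" "2 * b2 + b1\<^sup>2 = 0" "2 * b3 + 2 * b1 * b2 = 0"
  "2 * b4 + 2 * b1 * b3 + b2\<^sup>2 = 0" "2 * lam * (2 * b5 + 2 * b1 * b4 + 2 * b2 * b3) = 9 / 16"
  using lam by (simp_all add: b_defs field_simps eval_nat_numeral)

definition q :: "real \<Rightarrow> complex" where
  "q x = 1 + b1 / of_real x + b2 / of_real x ^ 2 + b3 / of_real x ^ 3 + b4 / of_real x ^ 4 + b5 / of_real x ^ 5"

definition q1 :: "real \<Rightarrow> complex" where
  "q1 x = - (b1 / of_real x ^ 2 + 2 * b2 / of_real x ^ 3 + 3 * b3 / of_real x ^ 4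
     + 4 * b4 / of_real x ^ 5 + 5 * b5 / of_real x ^ 6)"

definition q2 :: "real \<Rightarrow> complex" where
  "q2 x = 2 * b1 / of_real x ^ 3 + 6 * b2 / of_real x ^ 4 + 12 * b3 / of_real x ^ 5
     + 20 * b4 / of_real x ^ 6 + 30 * b5 / of_real x ^ 7"

lemma q_deriv: "x \<noteq> 0 \<Longrightarrow> (q has_vector_derivative q1 x) (at x)"
  using inverse_polynomial_deriv[of x 1 b1 b2 b3 b4 b5 0] by (simp add: q_def[abs_def] q1_def)

lemma q1_deriv: "x \<noteq> 0 \<Longrightarrow> (q1 has_vector_derivative q2 x) (at x)"
  using inverse_polynomial_deriv[of x 0 0 "- b1" "- 2 * b2" "- 3 * b3" "- 4 * b4" "- 5 * b5"]
  by (simp add: q1_def[abs_def] q2_def algebra_simps)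

definition \<theta> :: "real \<Rightarrow> complex" where
  "\<theta> x = csqrt (8 * lam / 25) * P1 lam x * of_real (x powr (5/2))"

definition \<theta>1 :: "real \<Rightarrow> complex" where
  "\<theta>1 x = a * of_real (x powr (3/2)) * q x"

text \<open>An equivalent form of the statement that \<open>x^(5/2) P1\<close> has derivative
  \<open>5/2 x^(3/2) q\<close>.\<close>

lemma P1_deriv:
  assumes "x \<noteq> 0"
  shows "(P1 lam has_vector_derivative (q x - P1 lam x) * 5 / (2 * of_real x)) (at x)"
proof -
  let ?c1 = "- 5 / (12 * lam)" and ?c2 = "- 5 / (32 * lam ^ 2)" and ?c3 = "5 / (128 * lam ^ 3)"
    and ?c4 = "25 / (6144 * lam ^ 4)" and ?c5 = "(7 - 1152 * lam ^ 4) / (8192 * lam ^ 5)"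
  have P1: "P1 lam x = 1 + ?c1 / of_real x + ?c2 / of_real x ^ 2 + ?c3 / of_real x ^ 3
      + ?c4 / of_real x ^ 4 + ?c5 / of_real x ^ 5" for x
    by (simp add: P1_def mult_ac)
  have b: "b1 = 3 / 5 * ?c1" "b2 = 1 / 5 * ?c2" "b3 = - 1 / 5 * ?c3" "b4 = - 3 / 5 * ?c4" "b5 = - ?c5"
    by (simp_all only: b_defs minus_divide_left) simp_all
  have "- (c1 / X ^ 2 + 2 * c2 / X ^ 3 + 3 * c3 / X ^ 4 + 4 * c4 / X ^ 5 + 5 * c5 / X ^ 6)
    = ((1 + 3 / 5 * c1 / X + 1 / 5 * c2 / X ^ 2 + - 1 / 5 * c3 / X ^ 3 + - 3 / 5 * c4 / X ^ 4 + - c5 / X ^ 5)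
      - (1 + c1 / X + c2 / X ^ 2 + c3 / X ^ 3 + c4 / X ^ 4 + c5 / X ^ 5)) * 5 / (2 * X)"
    if "X \<noteq> 0" for X c1 c2 c3 c4 c5 :: complex
    using that by (simp add: field_simps eval_nat_numeral)
  from this[of "of_real x" ?c1 ?c2 ?c3 ?c4 ?c5] assms
    inverse_polynomial_deriv[OF assms, of 1 ?c1 ?c2 ?c3 ?c4 ?c5 0]
  show ?thesis
    unfolding P1[abs_def] q_def b by simp
qed

lemma \<theta>_deriv:
  assumes "x > 0"
  shows "(\<theta> has_vector_derivative \<theta>1 x) (at x)"
proof -
  have "((\<lambda>x. x powr (5/2)) has_real_derivative 5 / 2 * x powr (3/2)) (at x)"
    using assms by (auto intro!: derivative_eq_intros)
  note d = has_vector_derivative_of_real[OF this, where 'a = complex]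
  have "x powr (5/2) = x * x powr (3/2)"
    using assms by (simp add: powr_mult_base)
  then have "csqrt (8 * lam / 25) * (P1 lam x * of_real (5 / 2 * x powr (3/2))
      + (q x - P1 lam x) * 5 / (2 * of_real x) * of_real (x powr (5/2))) = \<theta>1 x"
    using assms by (simp add: \<theta>1_def a_def field_simps)
  with has_vector_derivative_mult_right[OF has_vector_derivative_mult[OF P1_deriv d], of "csqrt (8 * lam / 25)"]
  show ?thesis using assms by (simp add: \<theta>_def[abs_def] mult.assoc)
qed

lemma q_tendsto: "(q \<longlongrightarrow> 1) at_top"
proof -
  have "((\<lambda>x. 1 + b1 * inverse (of_real x) + b2 * inverse (of_real x) ^ 2 + b3 * inverse (of_real x) ^ 3
      + b4 * inverse (of_real x) ^ 4 + b5 * inverse (of_real x) ^ 5)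
    \<longlongrightarrow> 1 + b1 * 0 + b2 * 0 ^ 2 + b3 * 0 ^ 3 + b4 * 0 ^ 4 + b5 * 0 ^ 5) at_top"
    by (intro tendsto_intros of_real_inverse_tendsto)
  then show ?thesis by (simp add: q_def[abs_def] divide_inverse power_inverse)
qed

text \<open>Below, \<open>\<pi>\<close> and \<open>\<beta>\<close> are the logarithmic derivatives of \<open>\<Psi> w\<close> and of \<open>\<theta>' = \<theta>1\<close>, so that the amplitude
  has logarithmic derivative \<open>- (\<pi> + \<beta>) / 2\<close>, and \<open>N\<close> is the residual of both approximate solutions
  relative to \<open>\<Psi> w\<close>.\<close>

definition \<pi> :: "real \<Rightarrow> complex" where
  "\<pi> x = - 2 * of_real x - 1 / of_real x + of_real (psi_log1 x)"

definition \<pi>1 :: "real \<Rightarrow> complex" where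
  "\<pi>1 x = - 2 + 1 / of_real x ^ 2 + of_real (psi_log2 x)"

definition \<beta> :: "real \<Rightarrow> complex" where
  "\<beta> x = 3 / (2 * of_real x) + q1 x / q x"

definition \<beta>1 :: "real \<Rightarrow> complex" where
  "\<beta>1 x = - 3 / (2 * of_real x ^ 2) + q2 x / q x - (q1 x / q x)\<^sup>2"

definition N :: "real \<Rightarrow> complex" where
  "N x = 2 * lam * of_real x ^ 3 / of_real (psi_num x) - (\<theta>1 x)\<^sup>2 - (\<pi>1 x + \<beta>1 x) / 2
     - ((\<pi> x)\<^sup>2 - (\<beta> x)\<^sup>2) / 4"

text \<open>By \<open>b_relations\<close>, \<open>2 lam q^2\<close> agrees with
  \<open>2 lam - y + 9/16 y^5\<close> up to a multiple of \<open>y^6\<close>. The factor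
  \<open>x^3\<close> in front and the \<open>x^3\<close> of the equation absorb exactly this
  \<open>y^6\<close>, so a polynomial in \<open>y\<close> remains.\<close>

lemma phase_residual:
  assumes "x \<noteq> 0"
  defines "y \<equiv> inverse (of_real x) :: complex"
  shows "of_real x ^ 3 * (2 * lam * of_real x ^ 3 - of_real x ^ 2 + 9 / (16 * of_real x ^ 2)
      - 2 * lam * of_real x ^ 3 * (q x)\<^sup>2)
    = - 2 * lam * ((2 * b1 * b5 + 2 * b2 * b4 + b3\<^sup>2) + (2 * b2 * b5 + 2 * b3 * b4) * y
        + (2 * b3 * b5 + b4\<^sup>2) * y ^ 2 + 2 * b4 * b5 * y ^ 3 + b5\<^sup>2 * y ^ 4)" (is "?L = - 2 * lam * ?c")
proof -
  have xy: "of_real x * y = 1" using assms by simp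
  have q: "q x = 1 + b1 * y + b2 * y ^ 2 + b3 * y ^ 3 + b4 * y ^ 4 + b5 * y ^ 5"
    by (simp add: q_def y_def divide_inverse power_inverse)
  have "(q x)\<^sup>2 = 1 + (2 * b1) * y + (2 * b2 + b1\<^sup>2) * y ^ 2 + (2 * b3 + 2 * b1 * b2) * y ^ 3
      + (2 * b4 + 2 * b1 * b3 + b2\<^sup>2) * y ^ 4 + (2 * b5 + 2 * b1 * b4 + 2 * b2 * b3) * y ^ 5 + y ^ 6 * ?c"
    unfolding q by algebra
  then have "(q x)\<^sup>2 = 1 + (2 * b1) * y + (2 * b5 + 2 * b1 * b4 + 2 * b2 * b3) * y ^ 5 + y ^ 6 * ?c"
    unfolding b_relations by simp
  moreover have "2 * lam * Q = 2 * lam - y + 9 / 16 * y ^ 5 + 2 * lam * w"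
    if "Q = 1 + u * y + v * y ^ 5 + w" "2 * lam * u = - 1" "2 * lam * v = 9 / 16" for Q u v w
    using that by algebra
  ultimately have *: "2 * lam * (q x)\<^sup>2 = 2 * lam - y + 9 / 16 * y ^ 5 + 2 * lam * (y ^ 6 * ?c)"
    using b_relations(1,5) by blast
  have "?L = of_real x ^ 6 * (2 * lam - y + 9 / 16 * y ^ 5 - 2 * lam * (q x)\<^sup>2)"
    using assms by (simp add: y_def field_simps eval_nat_numeral)
  also have "\<dots> = - 2 * lam * ?c * (of_real x * y) ^ 6"
    unfolding * by (simp add: algebra_simps power_mult_distrib)
  finally show ?thesis by (simp add: xy)
qed

text \<open>Separates the phase mismatch, the exponentially small contributions of
  \<open>psi_num\<close>, and the terms with derivatives of \<open>q\<close>. The constants and the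
  \<open>1/(4 x^2)\<close> terms cancel between \<open>\<pi>1\<close>, \<open>\<beta>1\<close> and
  \<open>\<pi>^2\<close>; the \<open>9/(16 x^2)\<close> is the leading part of
  \<open>\<beta>^2 / 4\<close>.\<close>

lemma N_decomposition:
  assumes "x > 0"
  shows "N x = (2 * lam * of_real x ^ 3 - of_real x ^ 2 + 9 / (16 * of_real x ^ 2)
        - 2 * lam * of_real x ^ 3 * (q x)\<^sup>2)
    + 2 * lam * of_real x ^ 3 * (1 / of_real (psi_num x) - 1)
    + (- of_real (psi_log2 x) / 2 + of_real (psi_log1 x) * of_real x + of_real (psi_log1 x) / (2 * of_real x)
       - of_real (psi_log1 x) ^ 2 / 4)
    - q2 x / q x / 2 + 3 / 4 * (q1 x / q x)\<^sup>2 + 3 / 4 * (q1 x / q x) / of_real x"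
proof -
  have "x powr (3/2) * x powr (3/2) = x ^ 3"
    using assms by (simp flip: powr_add)
  then have "(of_real (x powr (3/2)) :: complex)\<^sup>2 = of_real x ^ 3"
    by (simp add: power2_eq_square flip: of_real_mult of_real_power)
  then have "(\<theta>1 x)\<^sup>2 = 2 * lam * of_real x ^ 3 * (q x)\<^sup>2"
    by (simp add: \<theta>1_def power_mult_distrib a_squared)
  then have *: "N x = 2 * lam * of_real x ^ 3 * (1 / of_real (psi_num x)) - 2 * lam * of_real x ^ 3 * (q x)\<^sup>2
     - (\<pi>1 x + \<beta>1 x) / 2 - ((\<pi> x)\<^sup>2 - (\<beta> x)\<^sup>2) / 4"
    by (simp add: N_def)
  have alg: "T * k - Q - ((- 2 + 1 / X ^ 2 + f) + (- 3 / (2 * X ^ 2) + s - r\<^sup>2)) / 2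
      - ((- 2 * X - 1 / X + e)\<^sup>2 - (3 / (2 * X) + r)\<^sup>2) / 4
    = (T - X ^ 2 + 9 / (16 * X ^ 2) - Q) + T * (k - 1) + (- f / 2 + e * X + e / (2 * X) - e ^ 2 / 4)
      - s / 2 + 3 / 4 * r\<^sup>2 + 3 / 4 * r / X" if "X \<noteq> 0" for X e f k Q r s T :: complex
    using that by (simp add: field_simps power2_eq_square)
  show ?thesis
    unfolding * \<pi>_def \<pi>1_def \<beta>_def \<beta>1_def
    by (rule alg) (use assms in simp)
qed

text \<open>The phase mismatch, \<open>q2 / q\<close> and \<open>q1 / (q x)\<close> are all of order
  \<open>x^-3\<close>; \<open>(q1 / q)^2\<close> and the contributions of \<open>psi_num\<close> are
  smaller.\<close>

lemma N_bounded: "\<exists>L. ((\<lambda>x. of_real x ^ 3 * N x) \<longlongrightarrow> L) at_top"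
proof -
  let ?y = "\<lambda>x :: real. inverse (of_real x) :: complex"
  note [tendsto_intros] = of_real_inverse_tendsto q_tendsto
  have m: "((\<lambda>x. of_real (psi_num x) :: complex) \<longlongrightarrow> 1) at_top"
    using tendsto_of_real[OF psi_num_tendsto_1, where 'a = complex] by simp
  have m6: "((\<lambda>x. of_real x ^ 6 * (1 - of_real (psi_num x)) :: complex) \<longlongrightarrow> 0) at_top"
    using tendsto_of_real[OF psi_num_small, where 'a = complex] by simp
  note e = psi_log_small[THEN tendsto_of_real, where 'a = complex, simplified]
  have q1: "\<exists>L. ((\<lambda>x. of_real x ^ 2 * q1 x) \<longlongrightarrow> L) at_top"
  proof
    have "((\<lambda>x. - (b1 + 2 * b2 * ?y x + 3 * b3 * ?y x ^ 2 + 4 * b4 * ?y x ^ 3 + 5 * b5 * ?y x ^ 4))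
        \<longlongrightarrow> - (b1 + 2 * b2 * 0 + 3 * b3 * 0 ^ 2 + 4 * b4 * 0 ^ 3 + 5 * b5 * 0 ^ 4)) at_top"
      by (intro tendsto_intros)
    moreover have "\<forall>\<^sub>F x in at_top. - (b1 + 2 * b2 * ?y x + 3 * b3 * ?y x ^ 2 + 4 * b4 * ?y x ^ 3
        + 5 * b5 * ?y x ^ 4) = of_real x ^ 2 * q1 x"
      using eventually_gt_at_top[of 0]
      by eventually_elim (simp add: q1_def field_simps eval_nat_numeral)
    ultimately show "((\<lambda>x. of_real x ^ 2 * q1 x) \<longlongrightarrow> - b1) at_top"
      using Lim_transform_eventually by (fastforce simp: power2_eq_square)
  qed
  then obtain L1 where L1: "((\<lambda>x. of_real x ^ 2 * q1 x) \<longlongrightarrow> L1) at_top" ..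
  have q2: "\<exists>L. ((\<lambda>x. of_real x ^ 3 * q2 x) \<longlongrightarrow> L) at_top"
  proof
    have "((\<lambda>x. 2 * b1 + 6 * b2 * ?y x + 12 * b3 * ?y x ^ 2 + 20 * b4 * ?y x ^ 3 + 30 * b5 * ?y x ^ 4)
        \<longlongrightarrow> 2 * b1 + 6 * b2 * 0 + 12 * b3 * 0 ^ 2 + 20 * b4 * 0 ^ 3 + 30 * b5 * 0 ^ 4) at_top"
      by (intro tendsto_intros)
    moreover have "\<forall>\<^sub>F x in at_top. 2 * b1 + 6 * b2 * ?y x + 12 * b3 * ?y x ^ 2 + 20 * b4 * ?y x ^ 3
        + 30 * b5 * ?y x ^ 4 = of_real x ^ 3 * q2 x"
      using eventually_gt_at_top[of 0]
      by eventually_elim (simp add: q2_def field_simps eval_nat_numeral)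
    ultimately show "((\<lambda>x. of_real x ^ 3 * q2 x) \<longlongrightarrow>
        2 * b1 + 6 * b2 * 0 + 12 * b3 * 0 ^ 2 + 20 * b4 * 0 ^ 3 + 30 * b5 * 0 ^ 4) at_top"
      by (rule Lim_transform_eventually)
  qed
  then obtain L2 where L2: "((\<lambda>x. of_real x ^ 3 * q2 x) \<longlongrightarrow> L2) at_top" ..
  let ?c = "\<lambda>y. - 2 * lam * ((2 * b1 * b5 + 2 * b2 * b4 + b3\<^sup>2) + (2 * b2 * b5 + 2 * b3 * b4) * y
        + (2 * b3 * b5 + b4\<^sup>2) * y ^ 2 + 2 * b4 * b5 * y ^ 3 + b5\<^sup>2 * y ^ 4)"
  let ?f = "\<lambda>x. ?c (?y x) + 2 * lam * (of_real x ^ 6 * (1 - of_real (psi_num x))) / of_real (psi_num x)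
    + (- (of_real x ^ 3 * of_real (psi_log2 x)) / 2 + of_real x ^ 4 * of_real (psi_log1 x)
       + of_real x ^ 2 * of_real (psi_log1 x) / 2 - of_real x ^ 3 * of_real (psi_log1 x) ^ 2 / 4)
    - of_real x ^ 3 * q2 x / q x / 2 + 3 / 4 * (of_real x ^ 2 * q1 x / q x)\<^sup>2 * ?y x
    + 3 / 4 * (of_real x ^ 2 * q1 x / q x)"
  have lim: "(?f \<longlongrightarrow> ?c 0 + 2 * lam * 0 / 1 + (- 0 / 2 + 0 + 0 / 2 - 0 / 4)
      - L2 / 1 / 2 + 3 / 4 * (L1 / 1)\<^sup>2 * 0 + 3 / 4 * (L1 / 1)) at_top"
    by (intro tendsto_intros m m6 e L1 L2) auto
  have alg: "c + 2 * lam * (X ^ 6 * (1 - M)) / M + (- (X ^ 3 * f) / 2 + X ^ 4 * e + X ^ 2 * e / 2 - X ^ 3 * e ^ 2 / 4)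
      - X ^ 3 * s / 2 + 3 / 4 * (X ^ 2 * r)\<^sup>2 * inverse X + 3 / 4 * (X ^ 2 * r)
    = X ^ 3 * (R + 2 * lam * X ^ 3 * (1 / M - 1) + (- f / 2 + e * X + e / (2 * X) - e ^ 2 / 4)
      - s / 2 + 3 / 4 * r\<^sup>2 + 3 / 4 * r / X)"
    if "X \<noteq> 0" "M \<noteq> 0" "X ^ 3 * R = c" for X M c R e f r s :: complex
    unfolding that(3)[symmetric] using that(1,2) by (simp add: field_simps eval_nat_numeral)
  have "\<forall>\<^sub>F x in at_top. ?f x = of_real x ^ 3 * N x"
    using eventually_gt_at_top[of 0]
  proof eventually_elim
    case (elim x)
    have "of_real (psi_num x) \<noteq> (0 :: complex)" using psi_num_pos[OF elim] by simp
    moreover have "of_real x \<noteq> (0 :: complex)" using elim by simp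
    ultimately show ?case
      unfolding N_decomposition[OF elim] times_divide_eq_right[symmetric, of "of_real x ^ _" _ "q x"]
      using elim by (intro alg phase_residual) auto
  qed
  from Lim_transform_eventually[OF lim this] show ?thesis ..
qed

section \<open>Amplitude and flux of the approximate solutions\<close>

definition P :: "real \<Rightarrow> complex" where
  "P x = of_real (Psi x * weight x)"

lemma P_nonzero: "x > 0 \<Longrightarrow> P x \<noteq> 0"
  using Psi_weight_pos[of x] by (metis P_def less_irrefl of_real_eq_0_iff)

lemma P_deriv: "x > 0 \<Longrightarrow> (P has_vector_derivative \<pi> x * P x) (at x)"
  unfolding P_def[abs_def] \<pi>_def
  using has_vector_derivative_of_real[OF Psi_weight_deriv, of x, where 'a = complex] by simp

lemma lam_weight: "x > 0 \<Longrightarrow> 2 * lam * of_real x ^ 3 / of_real (psi_num x) * P x = lam * of_real (weight x)"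
  using psi_num_pos[of x] unfolding P_def Psi_weight
  by (simp add: weight_def field_simps eval_nat_numeral)

text \<open>The solution of \<open>P A^2 \<theta>1 = a / 2\<close> that behaves like
  \<open>x^(-1/4) exp (x^2 / 2)\<close>. Since \<open>q\<close> tends to 1, eventually
  \<open>Re (q x) > 0\<close>, which keeps the argument of \<open>csqrt\<close> off the branch
  cut.\<close>

definition amp :: "real \<Rightarrow> complex" where
  "amp x = of_real (x powr (-1/4) * exp (x\<^sup>2 / 2)) / csqrt (of_real (psi_num x) * q x)"

lemma amp_nonzero:
  assumes "x > 0" "Re (q x) > 0"
  shows "amp x \<noteq> 0"
  using assms psi_num_pos[of x] by (auto simp: amp_def)

lemma amp_deriv:
  assumes x: "x > 0" and q: "Re (q x) > 0"
  shows "(amp has_vector_derivative - (\<pi> x + \<beta> x) / 2 * amp x) (at x)"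
proof -
  let ?n = "\<lambda>x. x powr (-1/4) * exp (x\<^sup>2 / 2)"
  let ?m = "\<lambda>x. of_real (psi_num x) :: complex"
  let ?c = "csqrt (?m x * q x)"
  have m: "psi_num x > 0" by (rule psi_num_pos[OF x])
  have q0: "q x \<noteq> 0" using q by auto
  have "x powr (-5/4) = x powr (-1/4) / x"
    using x powr_mult_base[of x "-5/4"] by (simp add: field_simps)
  then have "(?n has_real_derivative ?n x * (x - 1 / (4 * x))) (at x)"
    using x by (auto intro!: derivative_eq_intros simp: field_simps)
  note n = has_vector_derivative_of_real[OF this, where 'a = complex]
  have mq: "((\<lambda>x. ?m x * q x) has_vector_derivative ?m x * q1 x + of_real (psi_num1 x) * q x) (at x)"
    using x by (intro has_vector_derivative_mult has_vector_derivative_of_real psi_num_deriv q_deriv) auto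
  have "Re (?m x * q x) > 0" using m q by simp
  then have "?m x * q x \<notin> \<real>\<^sub>\<le>\<^sub>0" by (auto simp: complex_nonpos_Reals_iff)
  then have c: "((\<lambda>x. csqrt (?m x * q x)) has_vector_derivative
      (?m x * q1 x + of_real (psi_num1 x) * q x) * inverse (2 * ?c)) (at x)"
    using field_vector_diff_chain_at[OF mq has_field_derivative_csqrt] by (simp add: o_def)
  have c0: "?c \<noteq> 0" using m q0 by simp
  have alg: "(N * w * C - N * ((M * r + M1 * Q) * inverse (2 * C))) / C\<^sup>2
      = - ((- 2 * X - 1 / X + M1 / M) + (3 / (2 * X) + r / Q)) / 2 * (N / C)"
    if "C \<noteq> 0" "M \<noteq> 0" "Q \<noteq> 0" "X \<noteq> 0" "C\<^sup>2 = M * Q" "w = X - 1 / (4 * X)"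
    for N w C M M1 r Q X :: complex
  proof -
    have "(N * w * C - N * ((M * r + M1 * Q) * inverse (2 * C))) / C\<^sup>2
        = N / C * (w - (M * r + M1 * Q) / (2 * C\<^sup>2))"
      using that(1) by (simp add: field_simps power2_eq_square)
    also have "\<dots> = N / C * (w - (r / Q + M1 / M) / 2)"
      unfolding that(5) using that(2,3) by (simp add: field_simps)
    also have "w - (r / Q + M1 / M) / 2 = - ((- 2 * X - 1 / X + M1 / M) + (3 / (2 * X) + r / Q)) / 2"
      unfolding that(6) using that(4) by (simp add: diff_divide_distrib add_divide_distrib)
    finally show ?thesis by (simp only: mult.commute)
  qed
  show ?thesis
    unfolding amp_def[abs_def]
    using alg[of ?c "?m x" "q x" "of_real x" "of_real (x - 1 / (4 * x))" "of_real (?n x)" "q1 x" "of_real (psi_num1 x)"]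
      has_vector_derivative_quotient[OF n c c0] c0 m q0 x
    by (simp add: \<pi>_def \<beta>_def psi_log1_def)
qed

lemma amp_square:
  assumes x: "x > 0" and q: "Re (q x) > 0"
  shows "P x * (amp x)\<^sup>2 * \<theta>1 x = a / 2"
proof -
  have "x powr (-1/4) * x powr (-1/4) * x powr (3/2) = x"
    using x by (simp flip: powr_add)
  then have 1: "(x powr (-1/4))\<^sup>2 * x powr (3/2) = x" by (simp add: power2_eq_square)
  have "(exp (x\<^sup>2 / 2))\<^sup>2 = exp (x\<^sup>2)"
    by (simp flip: exp_double)
  then have 2: "(exp (x\<^sup>2 / 2))\<^sup>2 * exp (- x\<^sup>2) = 1" by (simp flip: exp_add)
  have "Psi x * weight x * (x powr (-1/4) * exp (x\<^sup>2 / 2))\<^sup>2 * x powr (3/2)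
      = psi_num x / (2 * x) * ((x powr (-1/4))\<^sup>2 * x powr (3/2)) * ((exp (x\<^sup>2 / 2))\<^sup>2 * exp (- x\<^sup>2))"
    by (simp add: Psi_weight[OF x] power_mult_distrib)
  also have "\<dots> = psi_num x / 2" unfolding 1 2 using x by simp
  finally have "of_real (Psi x * weight x * (x powr (-1/4) * exp (x\<^sup>2 / 2))\<^sup>2 * x powr (3/2))
      = (of_real (psi_num x / 2) :: complex)" by (rule arg_cong)
  then have 3: "P x * (of_real (x powr (-1/4) * exp (x\<^sup>2 / 2)))\<^sup>2 * of_real (x powr (3/2))
      = of_real (psi_num x) / 2"
    by (simp only: P_def of_real_mult of_real_power of_real_divide of_real_numeral)
  have 4: "P x * (amp x)\<^sup>2 * \<theta>1 x = P x * (of_real (x powr (-1/4) * exp (x\<^sup>2 / 2)))\<^sup>2 * of_real (x powr (3/2))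
      * a * q x / (of_real (psi_num x) * q x)"
    by (simp add: amp_def \<theta>1_def power_divide)
  have "q x \<noteq> 0" using q by auto
  then show ?thesis unfolding 4 3 using psi_num_pos[OF x] by simp
qed

lemma \<pi>_deriv:
  assumes "x > 0"
  shows "(\<pi> has_vector_derivative \<pi>1 x) (at x)"
proof -
  have "((\<lambda>x. - 2 * x - 1 / x + psi_log1 x) has_real_derivative - 2 + 1 / x\<^sup>2 + psi_log2 x) (at x)"
    using assms by (auto intro!: derivative_eq_intros psi_log1_deriv simp: power2_eq_square)
  from has_vector_derivative_of_real[OF this, where 'a = complex] show ?thesis
    by (simp add: \<pi>_def[abs_def] \<pi>1_def)
qed

lemma \<beta>_deriv:
  assumes "x > 0" "q x \<noteq> 0"
  shows "(\<beta> has_vector_derivative \<beta>1 x) (at x)"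
proof -
  have "((\<lambda>x. 3 / (2 * x)) has_real_derivative - 3 / (2 * x\<^sup>2)) (at x)"
    using assms by (auto intro!: derivative_eq_intros simp: power2_eq_square field_simps)
  from has_vector_derivative_of_real[OF this, where 'a = complex]
  have "((\<lambda>x. 3 / (2 * of_real x)) has_vector_derivative - 3 / (2 * of_real x ^ 2 :: complex)) (at x)"
    by simp
  moreover have "(q2 x * q x - q1 x * q1 x) / (q x)\<^sup>2 = q2 x / q x - (q1 x / q x)\<^sup>2"
    using assms by (simp add: field_simps power2_eq_square)
  then have "((\<lambda>x. q1 x / q x) has_vector_derivative q2 x / q x - (q1 x / q x)\<^sup>2) (at x)"
    using has_vector_derivative_quotient[OF q1_deriv q_deriv, of x] assms by simp
  ultimately show ?thesis
    unfolding \<beta>_def[abs_def] \<beta>1_def add_diff_eq[symmetric] by (rule has_vector_derivative_add)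
qed

lemma \<theta>1_deriv:
  assumes "x > 0" "q x \<noteq> 0"
  shows "(\<theta>1 has_vector_derivative \<beta> x * \<theta>1 x) (at x)"
proof -
  have "x powr (3/2) = x * x powr (1/2)"
    using assms by (simp add: powr_mult_base)
  then have "((\<lambda>x. x powr (3/2)) has_real_derivative 3 / (2 * x) * x powr (3/2)) (at x)"
    using assms by (auto intro!: derivative_eq_intros)
  note d = has_vector_derivative_of_real[OF this, where 'a = complex]
  have "((\<lambda>x. a * (of_real (x powr (3/2)) * q x)) has_vector_derivative
      a * (of_real (x powr (3/2)) * q1 x + of_real (3 / (2 * x) * x powr (3/2)) * q x)) (at x)"
    using assms by (intro has_vector_derivative_mult_right has_vector_derivative_mult d q_deriv) auto
  moreover have "a * (of_real (x powr (3/2)) * q1 x + of_real (3 / (2 * x) * x powr (3/2)) * q x) = \<beta> x * \<theta>1 x"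
    using assms by (simp add: \<beta>_def \<theta>1_def field_simps)
  moreover have "(\<lambda>x. a * (of_real (x powr (3/2)) * q x)) = \<theta>1"
    by (simp add: \<theta>1_def fun_eq_iff mult.assoc)
  ultimately show ?thesis by (simp only:)
qed

text \<open>The logarithmic derivative of \<open>wkb s\<close>, so
  \<open>P x * \<zeta> s x * wkb s x\<close> is the flux of \<open>wkb s\<close>.\<close>

definition \<zeta> :: "complex \<Rightarrow> real \<Rightarrow> complex" where
  "\<zeta> s x = - (\<pi> x + \<beta> x) / 2 + s * \<i> * \<theta>1 x"

definition wkb :: "complex \<Rightarrow> real \<Rightarrow> complex" where
  "wkb s x = amp x * exp (s * \<i> * \<theta> x)"

lemma wkb_deriv:
  assumes "x > 0" "Re (q x) > 0"
  shows "(wkb s has_vector_derivative \<zeta> s x * wkb s x) (at x)"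
proof -
  have "((\<lambda>x. exp (s * \<i> * \<theta> x)) has_vector_derivative (s * \<i> * \<theta>1 x) * exp (s * \<i> * \<theta> x)) (at x)"
    using assms by (intro has_vector_derivative_exp has_vector_derivative_mult_right \<theta>_deriv)
  from has_vector_derivative_mult[OF amp_deriv[OF assms] this] show ?thesis
    by (simp add: wkb_def[abs_def] \<zeta>_def algebra_simps)
qed

text \<open>The flux has derivative \<open>P (\<pi> \<zeta> + \<zeta>' + \<zeta>^2) wkb\<close>. The
  terms linear in \<open>s\<close> add up to zero because the real amplitude part of
  \<open>\<zeta>\<close> is \<open>- (\<pi> + \<beta>) / 2\<close>; only \<open>s^2 = 1\<close>
  survives, so both signs share the residual \<open>N\<close>.\<close>

lemma wkb_flux_deriv:
  assumes x: "x > 0" and q: "Re (q x) > 0" and s: "s\<^sup>2 = 1"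
  shows "((\<lambda>x. P x * \<zeta> s x * wkb s x) has_vector_derivative
    (P x * N x - lam * of_real (weight x)) * wkb s x) (at x)"
proof -
  have q0: "q x \<noteq> 0" using q by auto
  have \<zeta>: "(\<zeta> s has_vector_derivative - (\<pi>1 x + \<beta>1 x) / 2 + s * \<i> * (\<beta> x * \<theta>1 x)) (at x)"
    unfolding \<zeta>_def[abs_def]
    by (intro has_vector_derivative_add has_vector_derivative_minus has_vector_derivative_divide
        has_vector_derivative_mult_right \<pi>_deriv \<beta>_deriv \<theta>1_deriv x q0)
  have "P x * N x - lam * of_real (weight x)
      = P x * (- (\<theta>1 x)\<^sup>2 - (\<pi>1 x + \<beta>1 x) / 2 - ((\<pi> x)\<^sup>2 - (\<beta> x)\<^sup>2) / 4)"
    unfolding lam_weight[OF x, symmetric] N_def by (simp add: algebra_simps)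
  also have "\<dots> = P x * (\<pi> x * \<zeta> s x + (- (\<pi>1 x + \<beta>1 x) / 2 + s * \<i> * (\<beta> x * \<theta>1 x)) + (\<zeta> s x)\<^sup>2)"
  proof -
    have "- t\<^sup>2 - d / 2 - (p\<^sup>2 - b\<^sup>2) / 4
        = p * (- (p + b) / 2 + j * t) + (- d / 2 + j * (b * t)) + (- (p + b) / 2 + j * t)\<^sup>2"
      if "j\<^sup>2 = - 1" for t d p b j :: complex
    proof -
      have "(- (p + b) / 2 + w)\<^sup>2 = (p + b)\<^sup>2 / 4 - (p + b) * w + w\<^sup>2" for w
        by (simp add: power2_eq_square field_simps)
      moreover have "(j * t)\<^sup>2 = - t\<^sup>2" by (simp add: power_mult_distrib that)
      ultimately show ?thesis by (simp only:) (simp add: power2_eq_square field_simps)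
    qed
    from this[of "s * \<i>" "\<theta>1 x" "\<pi>1 x + \<beta>1 x" "\<pi> x" "\<beta> x"] s show ?thesis
      by (simp add: \<zeta>_def power_mult_distrib)
  qed
  finally have *: "P x * N x - lam * of_real (weight x)
      = P x * (\<pi> x * \<zeta> s x + (- (\<pi>1 x + \<beta>1 x) / 2 + s * \<i> * (\<beta> x * \<theta>1 x)) + (\<zeta> s x)\<^sup>2)" .
  show ?thesis
    unfolding *
    by (rule has_vector_derivative_eq_rhs[OF has_vector_derivative_mult[OF
          has_vector_derivative_mult[OF P_deriv[OF x] \<zeta>] wkb_deriv[OF x q]]])
      (simp add: algebra_simps power2_eq_square)
qed

text \<open>Reduction of order brings in \<open>1 / (P wkb^2)\<close>. This identity turns it into a
  multiple of \<open>\<theta>1 / exp (2 s \<i> \<theta>)\<close>, the form that the Volterra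
  equation expects.\<close>

lemma wkb_square:
  assumes "x > 0" "Re (q x) > 0"
  shows "P x * (wkb s x)\<^sup>2 * \<theta>1 x = a / 2 * exp (2 * s * \<i> * \<theta> x)"
proof -
  have "(exp (s * \<i> * \<theta> x))\<^sup>2 = exp (2 * s * \<i> * \<theta> x)"
    by (simp add: mult.assoc flip: exp_double)
  moreover have "P x * (wkb s x)\<^sup>2 * \<theta>1 x = (P x * (amp x)\<^sup>2 * \<theta>1 x) * (exp (s * \<i> * \<theta> x))\<^sup>2"
    by (simp add: wkb_def power_mult_distrib)
  ultimately show ?thesis by (simp add: amp_square[OF assms])
qed

lemma \<theta>1_nonzero: "x > 0 \<Longrightarrow> Re (q x) > 0 \<Longrightarrow> \<theta>1 x \<noteq> 0"
  using a_nonzero by (auto simp: \<theta>1_def)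

section \<open>Solutions near infinity\<close>

lemma continuous_on_N_quotient:
  assumes "\<And>x. x \<in> S \<Longrightarrow> x > 0 \<and> Re (q x) > 0"
  shows "continuous_on S (\<lambda>x. N x / \<theta>1 x)"
proof -
  have pos: "x > 0" "psi_num x \<noteq> 0" "q x \<noteq> 0" "\<theta>1 x \<noteq> 0" if "x \<in> S" for x
    using assms[OF that] psi_num_pos[of x] \<theta>1_nonzero[of x] by auto
  have vd: "continuous_on S f" if "\<And>x. x \<in> S \<Longrightarrow> (f has_vector_derivative f' x) (at x)"
    for f f' :: "real \<Rightarrow> complex"
    using that by (intro continuous_at_imp_continuous_on) (auto intro: has_vector_derivative_continuous)
  have rd: "continuous_on S f" if "\<And>x. x \<in> S \<Longrightarrow> (f has_real_derivative f' x) (at x)" for f f'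
    using that by (intro continuous_at_imp_continuous_on) (auto intro: DERIV_isCont)
  have m: "continuous_on S psi_num" "continuous_on S psi_num1"
    by (rule rd[OF psi_num_deriv], rule rd[OF psi_num1_deriv])
  have l2: "continuous_on S psi_log2"
    unfolding psi_log2_def[abs_def] psi_num2_def using pos by (intro continuous_intros m) auto
  have q: "continuous_on S q" "continuous_on S q1" "continuous_on S \<pi>" "continuous_on S \<theta>1" "continuous_on S \<beta>"
    using pos by (auto intro!: vd[OF q_deriv] vd[OF q1_deriv] vd[OF \<pi>_deriv] vd[OF \<theta>1_deriv] vd[OF \<beta>_deriv])
  have q2: "continuous_on S q2"
    unfolding q2_def[abs_def] using pos by (intro continuous_intros) auto
  have "continuous_on S \<pi>1" "continuous_on S \<beta>1"
    unfolding \<pi>1_def[abs_def] \<beta>1_def[abs_def] using pos by (intro continuous_intros l2 q q2; force)+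
  then show ?thesis
    unfolding N_def[abs_def] using pos by (intro continuous_intros m q) auto
qed

lemma Re_exponent:
  "Re (2 * s * \<i> * \<theta>1 x) = 2 * x powr (3/2) * - (Re s * Im (a * q x))" if "Im s = 0"
  using that by (simp add: \<theta>1_def algebra_simps)

text \<open>If \<open>a\<close> is real then so is \<open>\<lambda> = a\<^sup>2 / 2\<close>, and the exponent is purely imaginary; otherwise the sign
  of its real part is eventually determined by \<open>Im a\<close>.\<close>

lemma exponent_dichotomy:
  assumes s: "s = 1 \<or> s = - 1" and B: "B > 0"
  shows "(\<forall>\<^sub>F x in at_top. Re (2 * s * \<i> * \<theta>1 x) \<le> 0) \<or>
    (\<forall>\<^sub>F x in at_top. 2 * (B * x powr (-9/2)) \<le> Re (2 * s * \<i> * \<theta>1 x) * (2 / 7 * B * x powr (-7/2)))"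
proof -
  define c where "c x = - (Re s * Im (a * q x))" for x
  have Ims: "Im s = 0" using s by auto
  note Re = Re_exponent[OF Ims, folded c_def]
  have c: "(c \<longlongrightarrow> - (Re s * Im (a * 1))) at_top"
    unfolding c_def by (intro tendsto_intros q_tendsto)
  consider "Im a = 0" | "- (Re s * Im a) < 0" | "- (Re s * Im a) > 0"
    using s by fastforce
  then show ?thesis
  proof cases
    case 1
    then have aR: "a \<in> \<real>" by (simp add: complex_is_Real_iff)
    then have "lam \<in> \<real>" using a_squared by (metis Reals_divide Reals_numeral Reals_power
        nonzero_mult_div_cancel_left zero_neq_numeral)
    then have "q x \<in> \<real>" for x
      unfolding q_def b_defs by (intro Reals_add Reals_divide Reals_minus Reals_diff Reals_mult
        Reals_power Reals_of_real Reals_numeral Reals_1)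
    then have "a * q x \<in> \<real>" for x using aR by simp
    then have "c x = 0" for x by (simp add: c_def complex_is_Real_iff)
    then show ?thesis unfolding Re by simp
  next
    case 2
    then have "\<forall>\<^sub>F x in at_top. c x < 0" using c by (intro order_tendstoD(2)) auto
    then have "\<forall>\<^sub>F x in at_top. Re (2 * s * \<i> * \<theta>1 x) \<le> 0"
      unfolding Re by eventually_elim (simp add: mult_nonneg_nonpos)
    then show ?thesis ..
  next
    case 3
    define c0 where "c0 = - (Re s * Im a)"
    have c0: "c0 > 0" using 3 by (simp add: c0_def)
    have "\<forall>\<^sub>F x in at_top. c0 / 2 < c x" using c c0 by (intro order_tendstoD(1)) (auto simp: c0_def)
    \<comment> \<open>The right-hand side is of order \<open>x^-2\<close>, so every positive
      \<open>c0\<close> suffices. The constant \<open>c0 / 7\<close> is \<open>2/7\<close> times the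
      lower bound \<open>c0 / 2\<close> of \<open>c\<close>.\<close>
    moreover have "\<forall>\<^sub>F x in at_top. x powr (-9/2) \<le> c0 / 7 * (x powr (3/2) * x powr (-7/2))"
      using c0 by real_asymp
    ultimately have "\<forall>\<^sub>F x in at_top. 2 * (B * x powr (-9/2))
        \<le> Re (2 * s * \<i> * \<theta>1 x) * (2 / 7 * B * x powr (-7/2))"
    proof eventually_elim
      case (elim x)
      have "x powr (-9/2) \<le> 2 / 7 * (c0 / 2) * (x powr (3/2) * x powr (-7/2))" using elim(2) by simp
      also have "\<dots> \<le> 2 / 7 * c x * (x powr (3/2) * x powr (-7/2))"
        using elim(1) by (intro mult_right_mono mult_left_mono) auto
      finally have "2 * B * x powr (-9/2) \<le> 2 * B * (2 / 7 * c x * (x powr (3/2) * x powr (-7/2)))"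
        using B by (intro mult_left_mono) auto
      then show ?case unfolding Re by (simp only: mult_ac)
    qed
    then show ?thesis ..
  qed
qed

text \<open>The formula for the flux \<open>v\<close>, with its small coefficient \<open>g\<close>,
  is part of the result because the Wronskian of the two solutions will be computed from it.\<close>

proposition local_solution:
  assumes s: "s = 1 \<or> s = - 1"
  shows "\<exists>X>0. \<exists>u v h g C. \<forall>x>X. Re (q x) > 0
    \<and> (u has_vector_derivative v x / P x) (at x)
    \<and> (v has_vector_derivative - lam * of_real (weight x) * u x) (at x)
    \<and> u x = wkb s x * h x
    \<and> v x = P x * \<zeta> s x * wkb s x * h x + a * s * \<i> * (g x * exp (2 * s * \<i> * \<theta> x)) / wkb s x
    \<and> norm (h x - 1) \<le> C * x powr (-7/2) \<and> norm (g x) \<le> C * x powr (-7/2)"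
proof -
  obtain L where L: "((\<lambda>x. of_real x ^ 3 * N x) \<longlongrightarrow> L) at_top" using N_bounded by blast
  \<comment> \<open>The limit of \<open>norm (x^3 N / (2 a q))\<close> plus 1 as slack. The kernel
    \<open>k\<close> is then at most \<open>B x^(-9/2)\<close>, whose tail integral is
    \<open>2/7 B x^(-7/2)\<close>.\<close>
  define B where "B = norm (L / (2 * a * 1)) + 1"
  have B: "B > 0" by (simp add: B_def add_nonneg_pos)
  have "((\<lambda>x. norm (of_real x ^ 3 * N x / (2 * a * q x))) \<longlongrightarrow> norm (L / (2 * a * 1))) at_top"
    using a_nonzero by (intro tendsto_intros L q_tendsto) auto
  then have ev1: "\<forall>\<^sub>F x in at_top. norm (of_real x ^ 3 * N x / (2 * a * q x)) < B"
    by (intro order_tendstoD(2)) (auto simp: B_def)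
  have ev2: "\<forall>\<^sub>F x in at_top. Re (q x) > 0"
    using order_tendstoD(1)[OF tendsto_Re[OF q_tendsto], of 0] by simp
  have ev3: "\<forall>\<^sub>F x in at_top. 2 / 7 * B * x powr (-7/2) \<le> 1 / 4"
    using B by real_asymp
  obtain X0 where X0: "\<And>x. x \<ge> X0 \<Longrightarrow> norm (of_real x ^ 3 * N x / (2 * a * q x)) < B
      \<and> Re (q x) > 0 \<and> 2 / 7 * B * x powr (-7/2) \<le> 1 / 4"
    using eventually_conj[OF ev1 eventually_conj[OF ev2 ev3]] unfolding eventually_at_top_linorder by blast
  obtain X1 where X1: "(\<forall>x\<ge>X1. Re (2 * s * \<i> * \<theta>1 x) \<le> 0) \<or>
    (\<forall>x\<ge>X1. 2 * (B * x powr (-9/2)) \<le> Re (2 * s * \<i> * \<theta>1 x) * (2 / 7 * B * x powr (-7/2)))"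
    using exponent_dichotomy[OF s B] unfolding eventually_at_top_linorder by blast
  define X where "X = max 1 (max X0 X1)"
  have X: "x > 0" "Re (q x) > 0" "norm (of_real x ^ 3 * N x / (2 * a * q x)) \<le> B" if "x \<ge> X" for x
    using X0[of x] that by (auto simp: X_def)
  interpret tail_majorant X "\<lambda>x. 2 / 7 * B * x powr (-7/2)" "\<lambda>x. B * x powr (-9/2)"
  proof
    fix t assume "t \<ge> X"
    then show "((\<lambda>x. 2 / 7 * B * x powr (-7/2)) has_real_derivative - (B * t powr (-9/2))) (at t)"
      using X(1)[of t] by (auto intro!: derivative_eq_intros)
    show "0 \<le> B * t powr (-9/2)" using B by simp
  next
    show "((\<lambda>x. 2 / 7 * B * x powr (-7/2)) \<longlongrightarrow> 0) at_top" by real_asymp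
  qed
  \<comment> \<open>With \<open>z = wkb s\<close> and \<open>u = z h\<close> the equation becomes
    \<open>(P z^2 h')' = - P N z^2 h\<close>. Putting \<open>P z^2 h' = a s \<i> G\<close> and using
    \<open>wkb_square\<close> gives the pair of equations for \<open>h\<close> and \<open>G\<close>
    with this kernel.\<close>
  define k where "k x = N x / (2 * s * \<i> * \<theta>1 x)" for x
  have s0: "s \<noteq> 0" "norm s = 1" "s\<^sup>2 = 1" using s by auto
  have "continuous_on {X..} (\<lambda>x. N x / \<theta>1 x / (2 * s * \<i>))"
    using X s0 by (intro continuous_intros continuous_on_N_quotient) auto
  then have k_cont: "continuous_on {X..} k"
    by (simp add: k_def[abs_def] mult_ac)
  have k_bound: "norm (k x) \<le> B * x powr (-9/2)" if "x \<ge> X" for x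
  proof -
    have x: "x > 0" using X(1)[OF that] .
    have "x powr 3 * x powr (3/2) * x powr (-9/2) = 1"
      unfolding powr_add[symmetric] using x by simp
    then have "x ^ 3 * x powr (3/2) * x powr (-9/2) = 1"
      using x by (simp add: powr_numeral)
    then have w: "x ^ 3 * x powr (-9/2) = 1 / x powr (3/2)"
      using x by (simp add: field_simps)
    have "norm (k x) = norm (N x) / (2 * norm a * norm (q x)) * (1 / x powr (3/2))"
      by (simp add: k_def \<theta>1_def norm_divide norm_mult s0)
    also have "\<dots> = norm (of_real x ^ 3 * N x / (2 * a * q x)) * x powr (-9/2)"
      unfolding w[symmetric] using x by (simp add: norm_divide norm_mult norm_power)
    also have "\<dots> \<le> B * x powr (-9/2)"
      using X(3)[OF that] by (intro mult_right_mono) auto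
    finally show ?thesis .
  qed
  have \<omega>: "((\<lambda>x. 2 * s * \<i> * \<theta> x) has_vector_derivative 2 * s * \<i> * \<theta>1 x) (at x)" if "x \<ge> X" for x
    using X(1)[OF that] by (intro has_vector_derivative_mult_right \<theta>_deriv)
  have small: "2 / 7 * B * X powr (-7/2) \<le> 1 / 4" using X0[of X] by (simp add: X_def)
  have dich: "(\<forall>x\<ge>X. Re (2 * s * \<i> * \<theta>1 x) \<le> 0) \<or>
    (\<forall>x\<ge>X. 2 * (B * x powr (-9/2)) \<le> Re (2 * s * \<i> * \<theta>1 x) * (2 / 7 * B * x powr (-7/2)))"
    using X1 by (elim disjE) (simp_all add: X_def)
  have "\<exists>h G C. \<forall>x>X. (h has_vector_derivative 2 * s * \<i> * \<theta>1 x * G x / exp (2 * s * \<i> * \<theta> x)) (at x)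
      \<and> (G has_vector_derivative - k x * exp (2 * s * \<i> * \<theta> x) * h x) (at x)
      \<and> norm (h x - 1) \<le> C * (2 / 7 * B * x powr (-7/2))
      \<and> norm (G x / exp (2 * s * \<i> * \<theta> x)) \<le> C * (2 / 7 * B * x powr (-7/2))"
    by (rule wkb_volterra[OF k_cont k_bound \<omega> small dich])
  then obtain h G C where hG: "\<forall>x>X. (h has_vector_derivative 2 * s * \<i> * \<theta>1 x * G x / exp (2 * s * \<i> * \<theta> x)) (at x)
      \<and> (G has_vector_derivative - k x * exp (2 * s * \<i> * \<theta> x) * h x) (at x)
      \<and> norm (h x - 1) \<le> C * (2 / 7 * B * x powr (-7/2))
      \<and> norm (G x / exp (2 * s * \<i> * \<theta> x)) \<le> C * (2 / 7 * B * x powr (-7/2))"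
    by (elim exE)
  define u where "u x = wkb s x * h x" for x
  define v where "v x = P x * \<zeta> s x * wkb s x * h x + a * s * \<i> * (G x / wkb s x)" for x
  show ?thesis
  proof (intro exI conjI allI impI)
    show "X > 0" by (simp add: X_def)
    fix x assume "x > X"
    then have x: "x > 0" "Re (q x) > 0" using X[of x] by auto
    define E where "E = exp (2 * s * \<i> * \<theta> x)"
    have h: "(h has_vector_derivative 2 * s * \<i> * \<theta>1 x * G x / E) (at x)"
      and G: "(G has_vector_derivative - k x * E * h x) (at x)"
      and bounds: "norm (h x - 1) \<le> C * (2 / 7 * B * x powr (-7/2))"
        "norm (G x / E) \<le> C * (2 / 7 * B * x powr (-7/2))"
      using hG \<open>x > X\<close> by (simp_all add: E_def)
    have z0: "wkb s x \<noteq> 0" using amp_nonzero[OF x] by (simp add: wkb_def)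
    have E0: "E \<noteq> 0" by (simp add: E_def)
    have P0: "P x \<noteq> 0" using P_nonzero[OF x(1)] .
    have t0: "\<theta>1 x \<noteq> 0" using \<theta>1_nonzero[OF x] .
    have sq: "a * E = 2 * (P x * (wkb s x)\<^sup>2 * \<theta>1 x)"
      unfolding wkb_square[OF x] by (simp add: E_def)
    show "Re (q x) > 0" by (rule x)
    have key: "wkb s x * (2 * s * \<i> * \<theta>1 x * G x / E) = a * s * \<i> * (G x / wkb s x) / P x"
    proof -
      have "z * (2 * s * \<i> * t * g / E) = a * s * \<i> * (g / z) / p"
        if "a * E = 2 * (p * z\<^sup>2 * t)" "z \<noteq> 0" "p \<noteq> 0" for z t g p
      proof -
        have "z * (2 * s * \<i> * t * g / E) = s * \<i> * g / (E * z * p) * (2 * (p * z\<^sup>2 * t))"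
          using that(2,3) by (simp add: power2_eq_square)
        also have "\<dots> = a * s * \<i> * (g / z) / p"
          unfolding that(1)[symmetric] using E0 by simp
        finally show ?thesis .
      qed
      from this[OF sq z0 P0] show ?thesis .
    qed
    have du: "(u has_vector_derivative wkb s x * (2 * s * \<i> * \<theta>1 x * G x / E) + \<zeta> s x * wkb s x * h x) (at x)"
      unfolding u_def by (intro has_vector_derivative_mult wkb_deriv x h)
    have "wkb s x * (2 * s * \<i> * \<theta>1 x * G x / E) + \<zeta> s x * wkb s x * h x = v x / P x"
      unfolding key v_def using P0 by (simp add: add_divide_distrib)
    with du show "(u has_vector_derivative v x / P x) (at x)" by simp
    have "(v has_vector_derivative
        (P x * \<zeta> s x * wkb s x * (2 * s * \<i> * \<theta>1 x * G x / E)
          + (P x * N x - lam * of_real (weight x)) * wkb s x * h x)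
        + a * s * \<i> * ((- k x * E * h x * wkb s x - G x * (\<zeta> s x * wkb s x)) / (wkb s x)\<^sup>2)) (at x)"
      unfolding v_def
      by (intro has_vector_derivative_add has_vector_derivative_mult has_vector_derivative_mult_right
          has_vector_derivative_quotient wkb_flux_deriv wkb_deriv x s0 z0 h G)
    moreover have "(P x * \<zeta> s x * wkb s x * (2 * s * \<i> * \<theta>1 x * G x / E)
          + (P x * N x - lam * of_real (weight x)) * wkb s x * h x)
        + a * s * \<i> * ((- k x * E * h x * wkb s x - G x * (\<zeta> s x * wkb s x)) / (wkb s x)\<^sup>2)
      = - lam * of_real (weight x) * u x"
    proof -
      have 1: "P x * \<zeta> s x * wkb s x * (2 * s * \<i> * \<theta>1 x * G x / E) = a * s * \<i> * \<zeta> s x * (G x / wkb s x)"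
        unfolding mult.assoc[of "P x * \<zeta> s x"] key using P0 by simp
      have 2: "a * s * \<i> * (k x * E) = P x * N x * (wkb s x)\<^sup>2"
      proof -
        have "a * s * \<i> * (k x * E) = N x / (2 * \<theta>1 x) * (a * E)"
          using s0 by (simp add: k_def)
        also have "\<dots> = P x * N x * (wkb s x)\<^sup>2"
          unfolding sq using t0 by simp
        finally show ?thesis .
      qed
      have "a * s * \<i> * ((- k x * E * h x * wkb s x - G x * (\<zeta> s x * wkb s x)) / (wkb s x)\<^sup>2)
          = - (a * s * \<i> * (k x * E)) * h x / wkb s x - a * s * \<i> * \<zeta> s x * (G x / wkb s x)"
        using z0 by (simp add: field_simps power2_eq_square)
      also have "\<dots> = - (P x * N x * wkb s x * h x) - a * s * \<i> * \<zeta> s x * (G x / wkb s x)"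
        unfolding 2 using z0 by (simp add: power2_eq_square)
      finally show ?thesis unfolding 1 by (simp add: u_def algebra_simps)
    qed
    ultimately show "(v has_vector_derivative - lam * of_real (weight x) * u x) (at x)" by (simp only:)
    show "u x = wkb s x * h x" by (simp add: u_def)
    \<comment> \<open>Fixes the witness \<open>g = G / exp (2 s \<i> \<theta>)\<close>, the quantity
      that the Volterra bound controls.\<close>
    show "v x = P x * \<zeta> s x * wkb s x * h x
        + a * s * \<i> * ((G x / exp (2 * s * \<i> * \<theta> x)) * exp (2 * s * \<i> * \<theta> x)) / wkb s x"
      by (simp add: v_def)
    show "norm (h x - 1) \<le> C * (2 / 7 * B) * x powr (-7/2)"
      "norm (G x / exp (2 * s * \<i> * \<theta> x)) \<le> C * (2 / 7 * B) * x powr (-7/2)"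
      using bounds by (simp_all add: E_def)
  qed
qed

section \<open>Global solutions and their asymptotics\<close>

definition is_solution_on :: "real set \<Rightarrow> (real \<Rightarrow> complex) \<Rightarrow> (real \<Rightarrow> complex) \<Rightarrow> bool" where
  "is_solution_on S u v \<longleftrightarrow> (\<forall>x\<in>S. (u has_vector_derivative v x / P x) (at x)
     \<and> (v has_vector_derivative - lam * of_real (weight x) * u x) (at x))"

text \<open>The equation as a first-order linear system for \<open>u\<close> and its flux
  \<open>v\<close>; the norms of the two coefficients add up to a Lipschitz constant.\<close>

lemma global_solution: "\<exists>u v. is_solution_on {0<..} u v \<and> u 1 = u0 \<and> v 1 = v0"
proof -
  define f where "f t y = (snd y / P t, - lam * of_real (weight t) * fst y)" for t and y :: "complex \<times> complex"
  let ?L = "\<lambda>t. norm (1 / P t) + norm (lam * of_real (weight t))"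
  have P: "continuous_on {0<..} P"
    using P_deriv by (intro continuous_at_imp_continuous_on) (auto intro: has_vector_derivative_continuous)
  have P0: "P t \<noteq> 0" if "t \<in> {0<..}" for t using P_nonzero that by simp
  have w: "continuous_on {0<..} weight"
    unfolding weight_def[abs_def] by (intro continuous_intros)
  have "\<exists>y. y 1 = (u0, v0) \<and> (\<forall>t>0. (y has_vector_derivative f t (y t)) (at t))"
  proof (rule linear_ode_solution_pos[where L = ?L])
    show "f t 0 = 0" for t by (simp add: f_def zero_prod_def)
    show "continuous_on {0<..} (\<lambda>t. f t (h t))" if "continuous_on {0<..} h" for h
      unfolding f_def using P0 by (intro continuous_intros that P w) auto
    show "continuous_on {0<..} ?L"
      using P0 by (intro continuous_intros P w) auto
    show "norm (f t x - f t y) \<le> ?L t * norm (x - y)" for t x y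
    proof -
      have "f t x - f t y = (1 / P t * snd (x - y), - lam * of_real (weight t) * fst (x - y))"
        by (simp add: f_def diff_divide_distrib algebra_simps)
      also have "norm \<dots> \<le> norm (1 / P t) * norm (snd (x - y)) + norm (lam * of_real (weight t)) * norm (fst (x - y))"
        by (rule order_trans[OF norm_Pair_le]) (simp add: norm_mult norm_divide)
      also have "\<dots> \<le> norm (1 / P t) * norm (x - y) + norm (lam * of_real (weight t)) * norm (x - y)"
        using norm_fst_le[of "fst (x - y)" "snd (x - y)"] norm_snd_le[of "snd (x - y)" "fst (x - y)"]
        unfolding prod.collapse by (intro add_mono mult_left_mono norm_ge_zero)
      finally show ?thesis by (simp only: distrib_right)
    qed
  qed simp
  then obtain y where y: "y 1 = (u0, v0)" "\<And>t. t > 0 \<Longrightarrow> (y has_vector_derivative f t (y t)) (at t)"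
    by (elim exE conjE) simp
  have "is_solution_on {0<..} (\<lambda>t. fst (y t)) (\<lambda>t. snd (y t))"
    unfolding is_solution_on_def
    using bounded_linear.has_vector_derivative[OF bounded_linear_fst y(2)]
      bounded_linear.has_vector_derivative[OF bounded_linear_snd y(2)]
    by (simp add: f_def)
  then show ?thesis
    by (intro exI[of _ "\<lambda>t. fst (y t)"] exI[of _ "\<lambda>t. snd (y t)"]) (simp add: y(1))
qed

text \<open>Formed with fluxes instead of derivatives, the Wronskian already contains the factor
  \<open>P\<close> of Abel's identity.\<close>

lemma wronskian_constant:
  assumes "is_solution_on {X<..} u1 v1" "is_solution_on {X<..} u2 v2" "X \<ge> 0"
  shows "\<exists>c. \<forall>x>X. u1 x * v2 x - u2 x * v1 x = c"
proof -
  have "((\<lambda>x. u1 x * v2 x - u2 x * v1 x) has_vector_derivative 0) (at x within {X<..})" if "x \<in> {X<..}" for x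
  proof -
    have "((\<lambda>x. u1 x * v2 x - u2 x * v1 x) has_vector_derivative
        (u1 x * (- lam * of_real (weight x) * u2 x) + v1 x / P x * v2 x)
        - (u2 x * (- lam * of_real (weight x) * u1 x) + v2 x / P x * v1 x)) (at x)"
      using assms(1,2) that unfolding is_solution_on_def
      by (intro has_vector_derivative_diff has_vector_derivative_mult) auto
    then have "((\<lambda>x. u1 x * v2 x - u2 x * v1 x) has_vector_derivative 0) (at x)"
      by (simp add: mult_ac)
    then show ?thesis by (rule has_vector_derivative_at_within)
  qed
  then obtain c where "\<And>x. x \<in> {X<..} \<Longrightarrow> u1 x * v2 x - u2 x * v1 x = c"
    using has_vector_derivative_zero_constant[of "{X<..}" "\<lambda>x. u1 x * v2 x - u2 x * v1 x"] by auto
  then show ?thesis by auto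
qed

text \<open>Cramer's rule: the Wronskians of the local solution with a global fundamental system are
  constant beyond \<open>X\<close>, and they are the coefficients of the extension. The initial
  values at 1 make the system's own Wronskian equal to 1.\<close>

lemma extend_solution:
  assumes sol: "is_solution_on {X<..} u v" and X: "X > 0"
  shows "\<exists>U V. is_solution_on {0<..} U V \<and> (\<forall>x>X. U x = u x \<and> V x = v x)"
proof -
  obtain f1 g1 where 1: "is_solution_on {0<..} f1 g1" "f1 1 = 1" "g1 1 = 0"
    using global_solution by blast
  obtain f2 g2 where 2: "is_solution_on {0<..} f2 g2" "f2 1 = 0" "g2 1 = 1"
    using global_solution by blast
  obtain w where w: "\<And>x. x > 0 \<Longrightarrow> f1 x * g2 x - f2 x * g1 x = w"
    using wronskian_constant[OF 1(1) 2(1)] by auto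
  from w[of 1] have "w = 1" using 1 2 by simp
  have loc: "is_solution_on {X<..} f1 g1" "is_solution_on {X<..} f2 g2"
    using 1(1) 2(1) X by (auto simp: is_solution_on_def)
  obtain c1 where c1: "\<And>x. x > X \<Longrightarrow> u x * g2 x - f2 x * v x = c1"
    using wronskian_constant[OF sol loc(2)] X by auto
  obtain c2 where c2: "\<And>x. x > X \<Longrightarrow> f1 x * v x - u x * g1 x = c2"
    using wronskian_constant[OF loc(1) sol] X by auto
  define U V where "U x = c1 * f1 x + c2 * f2 x" and "V x = c1 * g1 x + c2 * g2 x" for x
  have "is_solution_on {0<..} U V"
    unfolding is_solution_on_def
  proof (intro ballI conjI)
    fix x :: real assume x: "x \<in> {0<..}"
    have "(U has_vector_derivative c1 * (g1 x / P x) + c2 * (g2 x / P x)) (at x)"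
      unfolding U_def using 1(1) 2(1) x unfolding is_solution_on_def
      by (intro has_vector_derivative_add has_vector_derivative_mult_right) auto
    then show "(U has_vector_derivative V x / P x) (at x)"
      by (simp add: V_def add_divide_distrib)
    have "(V has_vector_derivative c1 * (- lam * of_real (weight x) * f1 x)
        + c2 * (- lam * of_real (weight x) * f2 x)) (at x)"
      unfolding V_def using 1(1) 2(1) x unfolding is_solution_on_def
      by (intro has_vector_derivative_add has_vector_derivative_mult_right) auto
    then show "(V has_vector_derivative - lam * of_real (weight x) * U x) (at x)"
      by (simp add: U_def algebra_simps)
  qed
  moreover have "U x = u x \<and> V x = v x" if "x > X" for x
  proof -
    have *: "f1 x * g2 x - f2 x * g1 x = 1" using w[of x] that X \<open>w = 1\<close> by simp
    have "U x = u x * (f1 x * g2 x - f2 x * g1 x)" "V x = v x * (f1 x * g2 x - f2 x * g1 x)"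
      unfolding U_def V_def c1[OF that, symmetric] c2[OF that, symmetric] by (simp_all add: algebra_simps)
    then show ?thesis by (simp add: *)
  qed
  ultimately show ?thesis by (intro exI[of _ U] exI[of _ V]) simp
qed

lemma is_solution_on_solves:
  assumes "is_solution_on {0<..} u v"
  shows "solves lam u"
  unfolding solves_def
proof (intro exI allI impI conjI)
  fix x :: real assume x: "x > 0"
  show "(u has_vector_derivative v x / P x) (at x)"
    using assms x by (simp add: is_solution_on_def)
  have "(v has_vector_derivative - lam * of_real (weight x) * u x) (at x)"
    using assms x by (simp add: is_solution_on_def)
  then show "((\<lambda>t. of_real (Psi t * weight t) * (v t / P t)) has_vector_derivative
      - lam * of_real (weight x) * u x) (at x)"
    by (rule has_vector_derivative_transform_within_open[of _ _ _ "{0<..}"])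
      (use x P_nonzero in \<open>auto simp: P_def simp del: of_real_mult\<close>)
qed simp

lemma lin_indep_if_wronskian:
  assumes 1: "is_solution_on {0<..} u1 v1" and 2: "is_solution_on {0<..} u2 v2"
    and x: "x > 0" and W: "u1 x * v2 x - u2 x * v1 x \<noteq> 0"
  shows "lin_indep_on_pos u1 u2"
  unfolding lin_indep_on_pos_def
proof (intro allI impI)
  fix c d assume *: "\<forall>x>0. c * u1 x + d * u2 x = 0"
  have "((\<lambda>x. c * u1 x + d * u2 x) has_vector_derivative c * (v1 x / P x) + d * (v2 x / P x)) (at x)"
    using 1 2 x unfolding is_solution_on_def
    by (intro has_vector_derivative_add has_vector_derivative_mult_right) auto
  moreover have "((\<lambda>x. c * u1 x + d * u2 x) has_vector_derivative 0) (at x)"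
    by (rule has_vector_derivative_transform_within_open[of "\<lambda>_. 0" _ _ "{0<..}"])
      (use x * in auto)
  ultimately have "c * (v1 x / P x) + d * (v2 x / P x) = 0"
    by (rule vector_derivative_unique_at)
  then have v: "c * v1 x + d * v2 x = 0"
    using P_nonzero[OF x] by (simp add: add_divide_distrib[symmetric])
  have u: "c * u1 x + d * u2 x = 0" using * x by simp
  have "c * (u1 x * v2 x - u2 x * v1 x) = 0" "d * (u1 x * v2 x - u2 x * v1 x) = 0"
    using u v by algebra+
  then show "c = 0 \<and> d = 0" using W by simp
qed

text \<open>The factors \<open>exp (\<plusminus>\<i> \<theta>)\<close> cancel, whichever of them
  grows. By \<open>amp_square\<close> the main terms give \<open>- \<i> a h1 h2\<close>, and the
  corrections are linear in \<open>g1\<close> and \<open>g2\<close>.\<close>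

lemma wkb_wronskian:
  assumes x: "x > 0" "Re (q x) > 0"
    and u: "u1 = wkb 1 x * h1" "u2 = wkb (- 1) x * h2"
    and v1: "v1 = P x * \<zeta> 1 x * wkb 1 x * h1 + a * 1 * \<i> * (g1 * exp (2 * 1 * \<i> * \<theta> x)) / wkb 1 x"
    and v2: "v2 = P x * \<zeta> (- 1) x * wkb (- 1) x * h2
      + a * - 1 * \<i> * (g2 * exp (2 * - 1 * \<i> * \<theta> x)) / wkb (- 1) x"
  shows "u1 * v2 - u2 * v1 = - \<i> * a * (h1 * h2 + h1 * g2 + h2 * g1)"
proof -
  define e where "e = exp (\<i> * \<theta> x)"
  have e: "e \<noteq> 0" by (simp add: e_def)
  have A: "amp x \<noteq> 0" by (rule amp_nonzero[OF x])
  have w: "wkb 1 x = amp x * e" "wkb (- 1) x = amp x / e"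
    by (simp_all add: wkb_def e_def exp_minus field_simps)
  have E: "exp (2 * 1 * \<i> * \<theta> x) = e\<^sup>2" "exp (2 * - 1 * \<i> * \<theta> x) = 1 / e\<^sup>2"
    by (simp_all add: e_def exp_minus field_simps flip: exp_double)
  have 1: "A * e * h1 * (p * z * (A / e) * h2 + a * - 1 * \<i> * (g2 * (1 / e\<^sup>2)) / (A / e))
      = p * A\<^sup>2 * z * h1 * h2 - a * \<i> * g2 * h1" if "A \<noteq> 0" for A p z
    using that e by (simp add: field_simps power2_eq_square)
  have 2: "A / e * h2 * (p * z * (A * e) * h1 + a * 1 * \<i> * (g1 * e\<^sup>2) / (A * e))
      = p * A\<^sup>2 * z * h1 * h2 + a * \<i> * g1 * h2" if "A \<noteq> 0" for A p z
    using that e by (simp add: field_simps power2_eq_square)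
  have "u1 * v2 - u2 * v1 = (P x * (amp x)\<^sup>2) * (\<zeta> (- 1) x - \<zeta> 1 x) * h1 * h2
      - a * \<i> * g2 * h1 - a * \<i> * g1 * h2"
    unfolding u v1 v2 w E 1[OF A] 2[OF A] by (simp add: algebra_simps)
  also have "\<zeta> (- 1) x - \<zeta> 1 x = - 2 * \<i> * \<theta>1 x" by (simp add: \<zeta>_def)
  also have "P x * (amp x)\<^sup>2 * (- 2 * \<i> * \<theta>1 x) = - \<i> * a"
    using amp_square[OF x] by (simp add: mult_ac)
  finally show ?thesis by (simp add: algebra_simps)
qed

section \<open>Comparison of the amplitude with the explicit prefactor\<close>

definition ratio :: "real \<Rightarrow> complex" where
  "ratio x = P0 lam x * csqrt (of_real (psi_num x) * q x)"

text \<open>\<open>ratio\<close> is the leading form divided by \<open>wkb\<close>. Its square is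
  free of \<open>csqrt\<close> and can be expanded in powers of \<open>1/x\<close>, so the estimate
  is proved for \<open>ratio^2 - 1\<close> first.\<close>

lemma ratio_asymptotics:
  "(ratio \<longlongrightarrow> 1) at_top" "\<exists>L. ((\<lambda>x. of_real x ^ 4 * (1 / ratio x - 1)) \<longlongrightarrow> L) at_top"
proof -
  note [tendsto_intros] = of_real_inverse_tendsto q_tendsto
  let ?y = "\<lambda>x :: real. inverse (of_real x) :: complex"
  let ?m = "\<lambda>x. of_real (psi_num x) :: complex"
  define d1 d2 d3 where "d1 = 1 / (8 * lam)" and "d2 = 5 / (128 * lam ^ 2)" and "d3 = 15 / (1024 * lam ^ 3)"
  have P0: "P0 lam x = 1 + d1 * ?y x + d2 * ?y x ^ 2 + d3 * ?y x ^ 3" for x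
    by (simp add: P0_def d1_def d2_def d3_def inverse_eq_divide power_one_over mult_ac)
  have "((\<lambda>x. 1 + d1 * ?y x + d2 * ?y x ^ 2 + d3 * ?y x ^ 3) \<longlongrightarrow> 1 + d1 * 0 + d2 * 0 ^ 2 + d3 * 0 ^ 3) at_top"
    by (intro tendsto_intros)
  then have P0_lim: "(P0 lam \<longlongrightarrow> 1) at_top" by (simp add: P0[abs_def])
  have m: "(?m \<longlongrightarrow> 1) at_top"
    using tendsto_of_real[OF psi_num_tendsto_1, where 'a = complex] by simp
  have m6: "((\<lambda>x. of_real x ^ 6 * (1 - ?m x)) \<longlongrightarrow> 0) at_top"
    using tendsto_of_real[OF psi_num_small, where 'a = complex] by simp
  have "((\<lambda>x. ?m x * q x) \<longlongrightarrow> 1 * 1) at_top" by (intro tendsto_intros m)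
  then have "((\<lambda>x. csqrt (?m x * q x)) \<longlongrightarrow> csqrt 1) at_top"
    by (intro isCont_tendsto_compose[where g = csqrt] continuous_at_csqrt) auto
  from tendsto_mult[OF P0_lim this] show ratio: "(ratio \<longlongrightarrow> 1) at_top"
    by (simp add: ratio_def[abs_def])
  \<comment> \<open>Coefficients of \<open>P0^2\<close> up to order three. The relations
    \<open>rel\<close> say that \<open>P0^2 q = 1 + O(x^-4)\<close>, which makes \<open>P0\<close>
    the truncation of \<open>q^(-1/2)\<close>.\<close>
  define f1 f2 f3 where "f1 = 2 * d1" and "f2 = 2 * d2 + d1\<^sup>2" and "f3 = 2 * d3 + 2 * d1 * d2"
  have rel: "f1 + b1 = 0" "f2 + f1 * b1 + b2 = 0" "f3 + f2 * b1 + f1 * b2 + b3 = 0"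
    using lam by (simp_all add: f1_def f2_def f3_def d1_def d2_def d3_def b_defs field_simps eval_nat_numeral)
  let ?F = "\<lambda>y. 1 + f1 * y + f2 * y ^ 2 + f3 * y ^ 3"
  let ?R = "\<lambda>y r. (f1 * b3 + f2 * b2 + f3 * b1) + (f2 * b3 + f3 * b2) * y + f3 * b3 * y ^ 2
    + (2 * d1 * d3 + d2\<^sup>2 + 2 * d2 * d3 * y + d3\<^sup>2 * y ^ 2) * r + ?F y * (b4 + b5 * y)"
  have expand: "(P0 lam x)\<^sup>2 * q x = 1 + ?y x ^ 4 * ?R (?y x) (q x)" for x
  proof -
    define y where "y = ?y x"
    define Q where "Q = 1 + b1 * y + b2 * y ^ 2 + b3 * y ^ 3"
    have q: "q x = Q + y ^ 4 * (b4 + b5 * y)"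
      by (simp add: q_def Q_def y_def divide_inverse power_inverse algebra_simps eval_nat_numeral)
    have 1: "(P0 lam x)\<^sup>2 = ?F y + y ^ 4 * (2 * d1 * d3 + d2\<^sup>2 + 2 * d2 * d3 * y + d3\<^sup>2 * y ^ 2)"
      unfolding P0 y_def[symmetric] f1_def f2_def f3_def by algebra
    have "?F y * Q = 1 + (f1 + b1) * y + (f2 + f1 * b1 + b2) * y ^ 2 + (f3 + f2 * b1 + f1 * b2 + b3) * y ^ 3
        + y ^ 4 * ((f1 * b3 + f2 * b2 + f3 * b1) + (f2 * b3 + f3 * b2) * y + f3 * b3 * y ^ 2)"
      unfolding Q_def by algebra
    then have 2: "?F y * Q = 1 + y ^ 4 * ((f1 * b3 + f2 * b2 + f3 * b1) + (f2 * b3 + f3 * b2) * y + f3 * b3 * y ^ 2)"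
      unfolding rel by simp
    have "(F + w * A) * Q' = 1 + w * (S + A * Q' + F * r)"
      if "F * Q = 1 + w * S" "Q' = Q + w * r" for F w A Q' S r
    proof -
      have "(F + w * A) * Q' = F * Q + w * (A * Q' + F * r)"
        unfolding that(2) by (simp add: algebra_simps)
      then show ?thesis unfolding that(1) by (simp add: algebra_simps)
    qed
    from this[OF 2 q] show ?thesis unfolding 1 y_def[symmetric] .
  qed
  have lim1: "((\<lambda>x. ?R (?y x) (q x) * ?m x - (P0 lam x)\<^sup>2 * q x * 0 - (of_real x ^ 6 * (1 - ?m x)) * ?y x ^ 2)
      \<longlongrightarrow> ?R 0 1 * 1 - 1\<^sup>2 * 1 * 0 - 0 * 0 ^ 2) at_top"
    by (intro tendsto_intros m m6 P0_lim)
  have ev1: "\<forall>\<^sub>F x in at_top. ?R (?y x) (q x) * ?m x - (P0 lam x)\<^sup>2 * q x * 0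
      - (of_real x ^ 6 * (1 - ?m x)) * ?y x ^ 2 = of_real x ^ 4 * ((ratio x)\<^sup>2 - 1)"
    using eventually_gt_at_top[of 0]
  proof eventually_elim
    case (elim x)
    have r: "(ratio x)\<^sup>2 = (P0 lam x)\<^sup>2 * q x * ?m x"
      by (simp add: ratio_def power_mult_distrib)
    have "(1 + w * R) * M - 1 = w * R * M - (1 - M)" for w R M :: complex
      by (simp add: algebra_simps)
    then have *: "(ratio x)\<^sup>2 - 1 = ?y x ^ 4 * ?R (?y x) (q x) * ?m x - (1 - ?m x)"
      unfolding r expand .
    have alg: "r * M - z * 0 - (X ^ 6 * (1 - M)) * inverse X ^ 2 = X ^ 4 * (inverse X ^ 4 * r * M - (1 - M))"
      if "X \<noteq> 0" for X r M z :: complex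
      using that by (simp add: field_simps eval_nat_numeral)
    show ?case unfolding * by (rule alg) (use elim in simp)
  qed
  obtain L where L: "((\<lambda>x. of_real x ^ 4 * ((ratio x)\<^sup>2 - 1)) \<longlongrightarrow> L) at_top"
    using Lim_transform_eventually[OF lim1 ev1] by (rule that)
  \<comment> \<open>Uses \<open>1/r - 1 = - (r^2 - 1) / (r (r + 1))\<close>, where the denominator
    tends to 2.\<close>
  have lim: "((\<lambda>x. - (of_real x ^ 4 * ((ratio x)\<^sup>2 - 1)) / (ratio x * (ratio x + 1))) \<longlongrightarrow> - L / (1 * (1 + 1))) at_top"
    by (intro tendsto_intros L ratio) auto
  have "\<forall>\<^sub>F x in at_top. dist (ratio x) 1 < 1"
    using ratio by (rule tendstoD) simp
  then have "\<forall>\<^sub>F x in at_top. - (of_real x ^ 4 * ((ratio x)\<^sup>2 - 1)) / (ratio x * (ratio x + 1))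
      = of_real x ^ 4 * (1 / ratio x - 1)"
  proof eventually_elim
    case (elim x)
    then have "ratio x \<noteq> 0" by auto
    moreover have "ratio x \<noteq> - 1" using elim by (auto simp: dist_norm)
    then have "ratio x + 1 \<noteq> 0" by (simp add: add_eq_0_iff2)
    moreover have "- (X * (r\<^sup>2 - 1)) / (r * (r + 1)) = X * (1 / r - 1)"
      if "r \<noteq> 0" "r + 1 \<noteq> 0" for r X :: complex
    proof -
      have "r\<^sup>2 - 1 = (r - 1) * (r + 1)" by (simp add: power2_eq_square algebra_simps)
      then have "- (X * (r\<^sup>2 - 1)) / (r * (r + 1)) = - (X * (r - 1)) / r" using that by simp
      then show ?thesis using that(1) by (simp add: field_simps)
    qed
    ultimately show ?case by blast
  qed
  from Lim_transform_eventually[OF lim this]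
  show "\<exists>L. ((\<lambda>x. of_real x ^ 4 * (1 / ratio x - 1)) \<longlongrightarrow> L) at_top" ..
qed

text \<open>The relative error is \<open>h / ratio - 1\<close>: \<open>h\<close> contributes
  \<open>x^(-7/2)\<close>, and replacing the amplitude by \<open>P0\<close> costs only
  \<open>x^-4\<close>.\<close>

lemma asymptotic_form:
  assumes ev: "\<forall>\<^sub>F x in at_top. Re (q x) > 0 \<and> u x = wkb s x * h x \<and> norm (h x - 1) \<le> C * x powr (-7/2)"
  shows "has_asymptotic_form lam s u"
  unfolding has_asymptotic_form_def
proof (intro exI conjI)
  let ?r = "\<lambda>x. h x / ratio x - 1"
  obtain L where L: "((\<lambda>x. of_real x ^ 4 * (1 / ratio x - 1)) \<longlongrightarrow> L) at_top"
    using ratio_asymptotics(2) by blast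
  have "\<forall>\<^sub>F x in at_top. norm (of_real x ^ 4 * (1 / ratio x - 1)) < norm L + 1"
    by (rule order_tendstoD(2)[OF tendsto_norm[OF L]]) simp
  moreover have "((\<lambda>x. norm (1 / ratio x)) \<longlongrightarrow> norm (1 / (1 :: complex))) at_top"
    by (intro tendsto_intros ratio_asymptotics) auto
  then have inv: "\<forall>\<^sub>F x in at_top. norm (1 / ratio x) < 2"
    by (rule order_tendstoD(2)) simp
  ultimately have "\<forall>\<^sub>F x in at_top. norm (?r x) \<le> (2 * C + (norm L + 1)) * norm (of_real (x powr (-7/2)) :: complex)"
    using ev eventually_ge_at_top[of 1]
  proof eventually_elim
    case (elim x)
    have hC: "norm (h x - 1) \<le> C * x powr (-7/2)" using elim by blast
    have "x powr - 4 \<le> x powr (-7/2)" using elim(4) by (intro powr_mono) auto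
    moreover have "x powr - 4 * x powr 4 = 1" unfolding powr_add[symmetric] using elim(4) by simp
    then have "x powr - 4 * x ^ 4 = 1" using elim(4) by (simp add: powr_numeral)
    then have "norm (1 / ratio x - 1) = norm (of_real x ^ 4 * (1 / ratio x - 1)) * x powr - 4"
      using elim(4) unfolding norm_mult by (simp add: norm_power mult_ac)
    ultimately have 1: "norm (1 / ratio x - 1) \<le> (norm L + 1) * x powr (-7/2)"
      using elim(1) by (auto intro!: mult_mono)
    have "norm ((h x - 1) * (1 / ratio x)) \<le> (C * x powr (-7/2)) * 2"
      unfolding norm_mult using hC elim(2) order_trans[OF norm_ge_zero hC]
      by (intro mult_mono) auto
    moreover have "?r x = (h x - 1) * (1 / ratio x) + (1 / ratio x - 1)"
      by (simp add: diff_divide_distrib)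
    then have "norm (?r x) \<le> norm ((h x - 1) * (1 / ratio x)) + norm (1 / ratio x - 1)"
      by (simp only: norm_triangle_ineq)
    ultimately have "norm (?r x) \<le> C * x powr (-7/2) * 2 + (norm L + 1) * x powr (-7/2)"
      using 1 by linarith
    then show ?case by (simp add: algebra_simps)
  qed
  then show "?r \<in> O[at_top](\<lambda>x. of_real (x powr (-7/2)))" by (rule bigoI)
  have "\<forall>\<^sub>F x in at_top. dist (ratio x) 1 < 1"
    using ratio_asymptotics(1) by (rule tendstoD) simp
  then show "\<forall>\<^sub>F x in at_top. u x = leading_form lam s x * (1 + ?r x)"
    using ev
  proof eventually_elim
    case (elim x)
    then have "ratio x \<noteq> 0" by auto
    then have "P0 lam x \<noteq> 0" "csqrt (of_real (psi_num x) * q x) \<noteq> 0" by (auto simp: ratio_def)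
    moreover have "leading_form lam s x
        = of_real (x powr (-1/4) * exp (x\<^sup>2 / 2)) * P0 lam x * exp (s * \<i> * \<theta> x)"
      by (simp add: leading_form_def \<theta>_def mult.assoc)
    ultimately show ?case
      using elim by (simp add: wkb_def amp_def ratio_def)
  qed
qed

end

theorem mainTheorem2:
  fixes lam :: complex
  assumes "lam \<noteq> 0"
  shows "\<exists>u_plus u_minus :: real \<Rightarrow> complex.
    solves lam u_plus \<and> solves lam u_minus \<and>
    lin_indep_on_pos u_plus u_minus \<and>
    has_asymptotic_form lam 1 u_plus \<and>
    has_asymptotic_form lam (-1) u_minus"
proof -
  interpret nonzero_eigenvalue lam by unfold_locales (rule assms)
  have ex: "\<exists>u v h g X. is_solution_on {0<..} u v \<and> (h \<longlongrightarrow> 1) at_top \<and> (g \<longlongrightarrow> 0) at_top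
      \<and> has_asymptotic_form lam s u
      \<and> (\<forall>x>X. Re (q x) > 0 \<and> u x = wkb s x * h x
          \<and> v x = P x * \<zeta> s x * wkb s x * h x + a * s * \<i> * (g x * exp (2 * s * \<i> * \<theta> x)) / wkb s x)"
    if s: "s = 1 \<or> s = - 1" for s
  proof -
    obtain X u v h g C where X: "X > 0" and sol: "\<forall>x>X. Re (q x) > 0
        \<and> (u has_vector_derivative v x / P x) (at x)
        \<and> (v has_vector_derivative - lam * of_real (weight x) * u x) (at x)
        \<and> u x = wkb s x * h x
        \<and> v x = P x * \<zeta> s x * wkb s x * h x + a * s * \<i> * (g x * exp (2 * s * \<i> * \<theta> x)) / wkb s x
        \<and> norm (h x - 1) \<le> C * x powr (-7/2) \<and> norm (g x) \<le> C * x powr (-7/2)"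
      using local_solution[OF s] by (elim exE conjE)
    have "is_solution_on {X<..} u v"
      unfolding is_solution_on_def Ball_def greaterThan_iff using sol by blast
    from extend_solution[OF this X] obtain U V where
      U: "is_solution_on {0<..} U V" "\<forall>x>X. U x = u x \<and> V x = v x"
      by (elim exE conjE)
    have ev: "\<forall>\<^sub>F x in at_top. norm (h x - 1) \<le> C * x powr (-7/2)" "\<forall>\<^sub>F x in at_top. norm (g x) \<le> C * x powr (-7/2)"
      using eventually_gt_at_top[of X] by (eventually_elim, use sol in blast)+
    have lim: "((\<lambda>x. C * x powr (-7/2)) \<longlongrightarrow> 0) at_top" by real_asymp
    have h0: "((\<lambda>x. h x - 1) \<longlongrightarrow> 0) at_top" and g0: "(g \<longlongrightarrow> 0) at_top"
      by (rule Lim_null_comparison[OF ev(1) lim], rule Lim_null_comparison[OF ev(2) lim])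
    from h0 have h1: "(h \<longlongrightarrow> 1) at_top" unfolding Lim_null[of h 1] .
    have form: "has_asymptotic_form lam s U"
    proof (rule asymptotic_form)
      show "\<forall>\<^sub>F x in at_top. Re (q x) > 0 \<and> U x = wkb s x * h x \<and> norm (h x - 1) \<le> C * x powr (-7/2)"
        using eventually_gt_at_top[of X] by eventually_elim (use sol U(2) in auto)
    qed
    have "\<forall>x>X. Re (q x) > 0 \<and> U x = wkb s x * h x
        \<and> V x = P x * \<zeta> s x * wkb s x * h x + a * s * \<i> * (g x * exp (2 * s * \<i> * \<theta> x)) / wkb s x"
      using U(2) sol by simp
    with U(1) h1 g0 form show ?thesis
      by (intro exI[of _ U] exI[of _ V] exI[of _ h] exI[of _ g] exI[of _ X] conjI)
  qed
  obtain u1 v1 h1 g1 X1 where 1: "is_solution_on {0<..} u1 v1" "(h1 \<longlongrightarrow> 1) at_top" "(g1 \<longlongrightarrow> 0) at_top"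
      "has_asymptotic_form lam 1 u1"
      "\<forall>x>X1. Re (q x) > 0 \<and> u1 x = wkb 1 x * h1 x
        \<and> v1 x = P x * \<zeta> 1 x * wkb 1 x * h1 x + a * 1 * \<i> * (g1 x * exp (2 * 1 * \<i> * \<theta> x)) / wkb 1 x"
    using ex[OF disjI1[OF refl]] by (elim exE conjE)
  obtain u2 v2 h2 g2 X2 where 2: "is_solution_on {0<..} u2 v2" "(h2 \<longlongrightarrow> 1) at_top" "(g2 \<longlongrightarrow> 0) at_top"
      "has_asymptotic_form lam (- 1) u2"
      "\<forall>x>X2. Re (q x) > 0 \<and> u2 x = wkb (- 1) x * h2 x
        \<and> v2 x = P x * \<zeta> (- 1) x * wkb (- 1) x * h2 x
          + a * - 1 * \<i> * (g2 x * exp (2 * - 1 * \<i> * \<theta> x)) / wkb (- 1) x"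
    using ex[OF disjI2[OF refl]] by (elim exE conjE)
  \<comment> \<open>The Wronskian tends to \<open>- \<i> a\<close>, which is nonzero, so it is
    nonzero at some large \<open>x\<close>; one such point suffices for independence.\<close>
  have "((\<lambda>x. - \<i> * a * (h1 x * h2 x + h1 x * g2 x + h2 x * g1 x)) \<longlongrightarrow> - \<i> * a * (1 * 1 + 1 * 0 + 1 * 0)) at_top"
    by (intro tendsto_intros 1(2,3) 2(2,3))
  then have "\<forall>\<^sub>F x in at_top. - \<i> * a * (h1 x * h2 x + h1 x * g2 x + h2 x * g1 x) \<noteq> 0"
    by (rule tendsto_imp_eventually_ne) (simp add: a_nonzero)
  then have "\<forall>\<^sub>F x in at_top. x > 0 \<and> x > X1 \<and> x > X2
      \<and> - \<i> * a * (h1 x * h2 x + h1 x * g2 x + h2 x * g1 x) \<noteq> 0"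
    by (intro eventually_conj eventually_gt_at_top)
  then obtain x where x: "x > 0" "x > X1" "x > X2"
      "- \<i> * a * (h1 x * h2 x + h1 x * g2 x + h2 x * g1 x) \<noteq> 0"
    using eventually_happens'[OF trivial_limit_at_top_linorder] by blast
  have "u1 x * v2 x - u2 x * v1 x \<noteq> 0"
    using wkb_wronskian[of x "u1 x" "h1 x" "u2 x" "h2 x" "v1 x" "g1 x" "v2 x" "g2 x"] 1(5) 2(5) x by simp
  from lin_indep_if_wronskian[OF 1(1) 2(1) x(1) this] show ?thesis
    using is_solution_on_solves[OF 1(1)] is_solution_on_solves[OF 2(1)] 1(4) 2(4) by blast
qed

end
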